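(* Let $\mathcal{R}=\{W_w,V_{w,v},\Lambda_w,\alpha_{w,v}\}_{w\in\Omega,v\in\Omega_w}$ be a continuous relay fusion frame for $H$. For each $w\in\Omega$ let $S_w$ be the frame operator of a frame for $K_w$. Put $\widehat{V}_{w,v}=S_w^{-1}V_{w,v}$ and $\widehat{\Lambda}_{w,v}=S_w^{-1}P_{V_{w,v}}\Lambda_w$. Then $\widehat{\mathcal{R}}=\{W_w,\widehat{V}_{w,v},\widehat{\Lambda}_{w,v},\alpha_{w,v}\}_{w\in\Omega,v\in\Omega_w}$ is a continuous relay fusion frame for $H$ and, with $S_{\widehat{\mathcal{R}}}$ denoting its frame operator, for all $f\in H$, $$f=\int_\Omega\int_{\Omega_w}\alpha_{w,v}^2S_{\widehat{\mathcal{R}}}^{-1}\pi_{W_w}\widehat{\Lambda}_{w,v}^{*}\widehat{\Lambda}_{w,v}\pi_{W_w}f\,d\mu(v)\,d\mu(w)=\int_\Omega\int_{\Omega_w}\alpha_{w,v}^2\pi_{W_w}\widehat{\Lambda}_{w,v}^{*}\widehat{\Lambda}_{w,v}\pi_{W_w}S_{\widehat{\mathcal{R}}}^{-1}f\,d\mu(v)\,d\mu(w).$$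
   Context: Setting. $H$ is a separable Hilbert space and $(\Omega,\mu)$ is a positive measure space; for each $w\in\Omega$, $\Omega_w$ is a positive measure space whose measure is also denoted $\mu$. For each $w\in\Omega$, $K_w$ is a separable Hilbert space, $W_w\subseteq H$ is a closed subspace, $\Lambda_w\in B(H,K_w)$, and $\{V_{w,v}\}_{v\in\Omega_w}$ is a family of closed subspaces of $K_w$; $\alpha_{w,v}>0$ are weights. $\pi_W$ and $P_V$ denote orthogonal projections onto closed subspaces $W$ of $H$ and $V$ of $K_w$. Families are understood to be measurable so that the integrals written make sense; vector-valued integrals are understood weakly. Definition. $\mathcal{R}=\{W_w,V_{w,v},\Lambda_w,\alpha_{w,v}\}_{w\in\Omega,v\in\Omega_w}$ is a continuous relay fusion frame for $H$ with bounds $A,B$ if: (1) for each $f\in H$, $\{\Lambda_wf\}_{w\in\Omega}$ is strongly measurable; (2) for each $f\in H$, $\{\pi_{W_w}f\}_{w\in\Omega}$ is strongly measurable; (3) for each $f\in K_w$, $\{P_{V_{w,v}}f\}_{w\in\Omega,v\in\Omega_w}$ is strongly measurable; (4) there are constants $0<A\le B<\infty$ such that $$A\|f\|^2\le\int_\Omega\int_{\Omega_w}\alpha_{w,v}^2\|P_{V_{w,v}}\Lambda_w\pi_{W_w}f\|^2\,d\mu(v)\,d\mu(w)\le B\|f\|^2\quad\forall f\in H.$$ Its frame operator is $S_{\mathcal{R}}f=\int_\Omega\int_{\Omega_w}\alpha_{w,v}^2\pi_{W_w}\Lambda_w^*P_{V_{w,v}}\Lambda_w\pi_{W_w}f\,d\mu(v)\,d\mu(w)$.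 The same definitions are applied to $\widehat{\mathcal{R}}$ with $\widehat{V}_{w,v}\subseteq K_w$ and $\widehat{\Lambda}_{w,v}\in B(H,K_w)$ in place of $V_{w,v}$ and $\Lambda_w$. The frame operator $S_w$ of a frame for $K_w$ is a bounded, positive, invertible operator on $K_w$.
   Formalization: The frames for the spaces K_w are assumed to have common frame bounds independent of w; without this the claim fails, e.g. for S_w = I/(w+1) on a Parseval relay fusion frame of l^2 with W_w = span{e_w}. *)

theory Defs
  imports "HOL-Analysis.Analysis"
begin

section \<open>Complex Hilbert spaces\<close>

text \<open>
  A complex Hilbert space is a complete real inner product space carrying a compatible complex
  structure: the real inner product, and hence the norm and the topology, is the one induced by
  the complex inner product, which is linear in its first argument.
  Separability is expressed by the additional sort constraint \<open>second_countable_topology\<close>.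
\<close>

class chilbert = real_inner + banach +
  fixes scaleC :: "complex \<Rightarrow> 'a \<Rightarrow> 'a" (infixr "*\<^sub>C" 75)
    and cinner :: "'a \<Rightarrow> 'a \<Rightarrow> complex"
  assumes scaleC_add_right: "c *\<^sub>C (x + y) = c *\<^sub>C x + c *\<^sub>C y"
    and scaleC_add_left: "(c + d) *\<^sub>C x = c *\<^sub>C x + d *\<^sub>C x"
    and scaleC_scaleC: "c *\<^sub>C (d *\<^sub>C x) = (c * d) *\<^sub>C x"
    and scaleC_of_real: "complex_of_real r *\<^sub>C x = r *\<^sub>R x"
    and cinner_commute: "cinner x y = cnj (cinner y x)"
    and cinner_add_left: "cinner (x + y) z = cinner x z + cinner y z"
    and cinner_scaleC_left: "cinner (c *\<^sub>C x) y = c * cinner x y"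
    and inner_eq_Re_cinner: "inner x y = Re (cinner x y)"

definition closed_csubspace :: "'a::chilbert set \<Rightarrow> bool" where
  "closed_csubspace V \<longleftrightarrow> closed V \<and> subspace V \<and> (\<forall>c. \<forall>x\<in>V. c *\<^sub>C x \<in> V)"

definition bounded_clinear :: "('a::chilbert \<Rightarrow> 'b::chilbert) \<Rightarrow> bool" where
  "bounded_clinear T \<longleftrightarrow> bounded_linear T \<and> (\<forall>c x. T (c *\<^sub>C x) = c *\<^sub>C T x)"

definition cadjoint :: "('a::chilbert \<Rightarrow> 'b::chilbert) \<Rightarrow> 'b \<Rightarrow> 'a" where
  "cadjoint T = (THE T'. \<forall>x y. cinner (T x) y = cinner x (T' y))"

definition proj :: "'a::chilbert set \<Rightarrow> 'a \<Rightarrow> 'a" where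
  "proj V x = (THE y. y \<in> V \<and> (\<forall>z\<in>V. cinner (x - y) z = 0))"


section \<open>Frames\<close>

text \<open>A frame for the closed subspace \<open>K\<close>, with bounds \<open>A\<close> and \<open>B\<close>.\<close>

definition frame_for ::
  "'i set \<Rightarrow> ('i \<Rightarrow> 'k::chilbert) \<Rightarrow> 'k set \<Rightarrow> real \<Rightarrow> real \<Rightarrow> bool" where
  "frame_for I e K A B \<longleftrightarrow>
     0 < A \<and> A \<le> B \<and> (\<forall>i\<in>I. e i \<in> K) \<and>
     (\<forall>x\<in>K. (\<lambda>i. (cmod (cinner x (e i)))\<^sup>2) summable_on I \<and>
        A * (norm x)\<^sup>2 \<le> (\<Sum>\<^sub>\<infinity>i\<in>I. (cmod (cinner x (e i)))\<^sup>2) \<and>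
        (\<Sum>\<^sub>\<infinity>i\<in>I. (cmod (cinner x (e i)))\<^sup>2) \<le> B * (norm x)\<^sup>2)"

definition frame_operator :: "'i set \<Rightarrow> ('i \<Rightarrow> 'k::chilbert) \<Rightarrow> 'k \<Rightarrow> 'k" where
  "frame_operator I e x = (\<Sum>\<^sub>\<infinity>i\<in>I. cinner x (e i) *\<^sub>C e i)"


section \<open>Weak iterated integrals\<close>

text \<open>
  \<open>x\<close> is the weak integral of \<open>F w v\<close> over \<open>v\<close> in \<open>N w\<close> and then \<open>w\<close> in \<open>M\<close>: pairing the
  integrand with any vector \<open>g\<close> and integrating twice gives \<open>cinner x g\<close>.
  As usual for iterated integrals, the inner integral need only exist for almost every \<open>w\<close>;
  \<open>h\<close> is a version of it.  The inner vector-valued integral need not itself define a vector: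
  the exceptional null set may depend on \<open>g\<close>.
\<close>

definition has_weak_integral ::
  "'w measure \<Rightarrow> ('w \<Rightarrow> 'v measure) \<Rightarrow> ('w \<Rightarrow> 'v \<Rightarrow> 'a::chilbert) \<Rightarrow> 'a \<Rightarrow> bool" where
  "has_weak_integral M N F x \<longleftrightarrow>
     (\<forall>g. \<exists>h. integrable M h \<and>
        (AE w in M. integrable (N w) (\<lambda>v. cinner (F w v) g) \<and>
                    h w = (\<integral>v. cinner (F w v) g \<partial>N w)) \<and>
        (\<integral>w. h w \<partial>M) = cinner x g)"


section \<open>Continuous relay fusion frames\<close>

text \<open>
  \<open>\<Omega>\<close> is \<open>M\<close> and \<open>\<Omega>\<^sub>w\<close> is \<open>N w\<close>.  The spaces \<open>K w\<close> are closed subspaces of one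
  separable Hilbert space (every family of separable Hilbert spaces can be realised in this way), an
  operator into \<open>K w\<close> is an operator into the ambient space with range in \<open>K w\<close>, and its adjoint
  is the restriction to \<open>K w\<close> of the ambient adjoint.

  Target spaces are separable, so strong measurability is Borel measurability.  A family
  indexed by pairs \<open>(w, v)\<close> lives on the disjoint union of the spaces \<open>N w\<close>, with its
  disjoint-union sigma-algebra: it is measurable iff each section in \<open>v\<close> is.
  The standing convention that the iterated integral makes sense is spelled out as
  measurability of the weights and of the inner integral.

  We first give the version in which the operators are indexed by pairs.
\<close>

definition relay_fusion_frame2 ::
  "'w measure \<Rightarrow> ('w \<Rightarrow> 'v measure) \<Rightarrow>
   ('w \<Rightarrow> 'k::{chilbert, second_countable_topology} set) \<Rightarrow>
   ('w \<Rightarrow> 'h::{chilbert, second_countable_topology} set) \<Rightarrow> ('w \<Rightarrow> 'v \<Rightarrow> 'k set) \<Rightarrow>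
   ('w \<Rightarrow> 'v \<Rightarrow> 'h \<Rightarrow> 'k) \<Rightarrow> ('w \<Rightarrow> 'v \<Rightarrow> real) \<Rightarrow> real \<Rightarrow> real \<Rightarrow> bool" where
  "relay_fusion_frame2 M N K W V L \<alpha> A B \<longleftrightarrow>
     (\<forall>w\<in>space M. closed_csubspace (K w) \<and> closed_csubspace (W w) \<and>
        (\<forall>v\<in>space (N w). closed_csubspace (V w v) \<and> V w v \<subseteq> K w \<and>
           bounded_clinear (L w v) \<and> range (L w v) \<subseteq> K w \<and> 0 < \<alpha> w v)) \<and>
     (\<forall>f. \<forall>w\<in>space M. (\<lambda>v. L w v f) \<in> borel_measurable (N w)) \<and>
     (\<forall>f. (\<lambda>w. proj (W w) f) \<in> borel_measurable M) \<and>
     (\<forall>w\<in>space M. \<forall>f\<in>K w. (\<lambda>v. proj (V w v) f) \<in> borel_measurable (N w)) \<and>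
     (\<forall>w\<in>space M. \<alpha> w \<in> borel_measurable (N w)) \<and>
     0 < A \<and> A \<le> B \<and>
     (\<forall>f. let q = (\<lambda>w. \<integral>\<^sup>+v. ennreal ((\<alpha> w v)\<^sup>2 *
                     (norm (proj (V w v) (L w v (proj (W w) f))))\<^sup>2) \<partial>N w)
          in q \<in> borel_measurable M \<and>
             ennreal (A * (norm f)\<^sup>2) \<le> (\<integral>\<^sup>+w. q w \<partial>M) \<and>
             (\<integral>\<^sup>+w. q w \<partial>M) \<le> ennreal (B * (norm f)\<^sup>2))"

text \<open>
  When the operators depend on \<open>w\<close> only, measurability in \<open>w\<close> is required of them instead; the
  corresponding clause above then holds trivially.
\<close>

definition relay_fusion_frame ::
  "'w measure \<Rightarrow> ('w \<Rightarrow> 'v measure) \<Rightarrow>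
   ('w \<Rightarrow> 'k::{chilbert, second_countable_topology} set) \<Rightarrow>
   ('w \<Rightarrow> 'h::{chilbert, second_countable_topology} set) \<Rightarrow> ('w \<Rightarrow> 'v \<Rightarrow> 'k set) \<Rightarrow>
   ('w \<Rightarrow> 'h \<Rightarrow> 'k) \<Rightarrow> ('w \<Rightarrow> 'v \<Rightarrow> real) \<Rightarrow> real \<Rightarrow> real \<Rightarrow> bool" where
  "relay_fusion_frame M N K W V \<Lambda> \<alpha> A B \<longleftrightarrow>
     (\<forall>w\<in>space M. bounded_clinear (\<Lambda> w) \<and> range (\<Lambda> w) \<subseteq> K w) \<and>
     (\<forall>f. (\<lambda>w. \<Lambda> w f) \<in> borel_measurable M) \<and>
     relay_fusion_frame2 M N K W V (\<lambda>w v. \<Lambda> w) \<alpha> A B"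

definition relay_frame_operator ::
  "'w measure \<Rightarrow> ('w \<Rightarrow> 'v measure) \<Rightarrow> ('w \<Rightarrow> 'h::chilbert set) \<Rightarrow> ('w \<Rightarrow> 'v \<Rightarrow> 'k::chilbert set) \<Rightarrow>
   ('w \<Rightarrow> 'v \<Rightarrow> 'h \<Rightarrow> 'k) \<Rightarrow> ('w \<Rightarrow> 'v \<Rightarrow> real) \<Rightarrow> 'h \<Rightarrow> 'h" where
  "relay_frame_operator M N W V L \<alpha> f =
     (THE x. has_weak_integral M N
        (\<lambda>w v. (\<alpha> w v)\<^sup>2 *\<^sub>R
           proj (W w) (cadjoint (L w v) (proj (V w v) (L w v (proj (W w) f))))) x)"

end

theory Submission
  imports Defs
begin

text \<open>
  A frame operator satisfies \<open>C \<parallel>x\<parallel>\<^sup>2 \<le> \<langle>S\<^sub>w x, x\<rangle>\<close> and \<open>\<parallel>S\<^sub>w x\<parallel> \<le> D \<parallel>x\<parallel>\<close>, so \<open>S\<^sub>w\<^sup>-\<^sup>1\<close> distorts norms by factors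
  between \<open>1 / D\<close> and \<open>1 / C\<close>; since \<open>\<Lambda>'\<^sub>w\<^sub>v f \<in> V'\<^sub>w\<^sub>v\<close>, this carries the frame inequalities over to the new
  family with bounds \<open>A / D\<^sup>2\<close> and \<open>B / C\<^sup>2\<close>.  The new frame operator represents the bounded coercive
  symmetric form \<open>\<integral>\<integral> \<langle>\<Psi> f, \<Psi> g\<rangle>\<close> with \<open>\<Psi> = \<alpha> \<Lambda>' \<pi>\<^sub>W\<close>, obtained from its quadratic form by polarisation, hence is
  bijective and self-adjoint, which gives both reconstruction formulas.

  The projection onto \<open>S\<^sub>w\<^sup>-\<^sup>1 V\<close> depends measurably on \<open>V\<close> because it is the limit of the Richardson iteration for
  the normal equations, each step of which only applies \<open>P\<^sub>V\<close> and \<open>S\<^sub>w\<^sup>-\<^sup>1\<close>.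

  Real inner products suffice throughout: the complex one is recovered from
  \<open>\<langle>x, y\<rangle>\<close> and \<open>\<langle>x, \<i> y\<rangle>\<close>.
\<close>

section \<open>Projections and adjoints\<close>

lemma cinner_scaleC_right: "cinner x (c *\<^sub>C y) = cnj c * cinner x y"
  by (metis cinner_commute cinner_scaleC_left complex_cnj_mult)

text \<open>The second slot is conjugate linear, so \<open>Re\<close> of the pairing with
  \<open>\<i> *\<^sub>C y\<close> is the imaginary part. This reduces complex identities to real
  ones.\<close>

lemma cinner_eq_Complex: "cinner x y = Complex (inner x y) (inner x (\<i> *\<^sub>C y))"
  by (simp add: complex_eq_iff inner_eq_Re_cinner cinner_scaleC_right)

lemma norm_scaleC: "norm (c *\<^sub>C (x::'a::chilbert)) = cmod c * norm x"
proof -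
  have "(norm (c *\<^sub>C x))\<^sup>2 = Re (c * cnj c * cinner x x)"
    by (simp add: power2_norm_eq_inner inner_eq_Re_cinner cinner_scaleC_right cinner_scaleC_left
        algebra_simps)
  also have "c * cnj c = complex_of_real ((cmod c)\<^sup>2)"
    by (rule complex_norm_square[symmetric])
  also have "Re (complex_of_real ((cmod c)\<^sup>2) * cinner x x) = (cmod c)\<^sup>2 * (norm x)\<^sup>2"
    by (simp add: power2_norm_eq_inner inner_eq_Re_cinner flip: of_real_power)
  finally show ?thesis
    by (simp flip: power_mult_distrib)
qed

lemma bounded_linear_scaleC: "bounded_linear (\<lambda>x::'a::chilbert. c *\<^sub>C x)"
proof (rule bounded_linear_intro[where K="cmod c"])
  show "c *\<^sub>C (r *\<^sub>R x) = r *\<^sub>R (c *\<^sub>C x)" for r and x :: 'a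
    by (simp flip: scaleC_of_real add: scaleC_scaleC mult.commute)
qed (simp_all add: scaleC_add_right norm_scaleC mult.commute)

lemma closed_csubspaceD:
  assumes "closed_csubspace V"
  shows "closed V" "subspace V" "x \<in> V \<Longrightarrow> c *\<^sub>C x \<in> V"
  using assms by (auto simp: closed_csubspace_def)

text \<open>The representing vector minimises \<open>\<parallel>x\<parallel>\<^sup>2 - 2 \<phi> x\<close>; minimising sequences are Cauchy by the
  parallelogram law.\<close>

lemma riesz_on_closed_subspace:
  fixes \<phi> :: "'a::{real_inner, banach} \<Rightarrow> real"
  assumes V: "closed V" "subspace V" and \<phi>: "bounded_linear \<phi>"
  obtains y where "y \<in> V" "\<And>z. z \<in> V \<Longrightarrow> \<phi> z = inner y z"
proof -
  interpret \<phi>: bounded_linear \<phi> by fact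
  obtain b where b: "0 \<le> b" "\<And>x. norm (\<phi> x) \<le> norm x * b"
    using \<phi>.nonneg_bounded by blast
  define J where "J x = (norm x)\<^sup>2 - 2 * \<phi> x" for x
  define m where "m = Inf (J ` V)"
  have J_lb: "J x \<ge> - b\<^sup>2" for x
  proof -
    have "0 \<le> (norm x - b)\<^sup>2" by simp
    moreover have "\<phi> x \<le> norm x * b" using b(2)[of x] by simp
    ultimately show ?thesis by (simp add: J_def power2_diff)
  qed
  have bdd: "bdd_below (J ` V)" using J_lb by (auto intro!: bdd_belowI)
  have m_le: "m \<le> J x" if "x \<in> V" for x
    unfolding m_def using bdd that by (auto intro!: cInf_lower)
  have V0: "0 \<in> V" using V(2) by (rule subspace_0)
  have "\<exists>x\<in>V. J x < m + 1 / Suc n" for n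
  proof -
    have "J ` V \<noteq> {}" "Inf (J ` V) < m + 1 / Suc n" using V0 by (auto simp: m_def)
    from cInf_lessD[OF this] show ?thesis by auto
  qed
  then obtain X where X: "\<And>n. X n \<in> V" "\<And>n. J (X n) < m + 1 / Suc n" by metis
  \<comment> \<open>Parallelogram law: the midpoint lies in \<open>V\<close>, so \<open>J\<close>
    there is at least \<open>m\<close>.\<close>
  have key: "(norm (x - y))\<^sup>2 \<le> 2 * (J x - m) + 2 * (J y - m)" if "x \<in> V" "y \<in> V" for x y
  proof -
    have J_half: "4 * J ((1/2) *\<^sub>R z) = (norm z)\<^sup>2 - 4 * \<phi> z" for z
      by (simp add: J_def \<phi>.scaleR power_divide)
    have "(1/2) *\<^sub>R (x + y) \<in> V" using that V(2) by (simp add: subspace_add subspace_mul)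
    from m_le[OF this] have "4 * m \<le> 4 * J ((1/2) *\<^sub>R (x + y))" by simp
    also have "\<dots> = (norm (x + y))\<^sup>2 - 4 * (\<phi> x + \<phi> y)"
      by (simp only: J_half \<phi>.add)
    also have "(norm (x + y))\<^sup>2 = 2 * (norm x)\<^sup>2 + 2 * (norm y)\<^sup>2 - (norm (x - y))\<^sup>2"
      by (simp add: power2_norm_eq_inner inner_simps inner_commute)
    finally show ?thesis by (simp add: J_def)
  qed
  have "Cauchy X"
  proof (rule metric_CauchyI)
    fix r :: real assume "0 < r"
    \<comment> \<open>Each gap enters \<open>key\<close> with factor 2, so a gap below
      \<open>r^2 / 4\<close> on both sides yields \<open>r^2\<close>.\<close>
    then obtain k where k: "1 / Suc k < r\<^sup>2 / 4"
      using reals_Archimedean[of "r\<^sup>2 / 4"] by (auto simp: inverse_eq_divide)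
    show "\<exists>M. \<forall>m\<ge>M. \<forall>n\<ge>M. dist (X m) (X n) < r"
    proof (intro exI allI impI)
      fix i j assume ij: "k \<le> i" "k \<le> j"
      have "J (X n) - m < r\<^sup>2 / 4" if "k \<le> n" for n
      proof -
        have "1 / Suc n \<le> 1 / Suc k" using that by (simp add: frac_le)
        with X(2)[of n] k show ?thesis by linarith
      qed
      from this[OF ij(1)] this[OF ij(2)]
      have "2 * (J (X i) - m) + 2 * (J (X j) - m) < r\<^sup>2" by argo
      with key[OF X(1)[of i] X(1)[of j]] have "(norm (X i - X j))\<^sup>2 < r\<^sup>2" by (rule order_le_less_trans)
      then show "dist (X i) (X j) < r"
        using \<open>0 < r\<close> by (metis dist_norm less_eq_real_def power_less_imp_less_base)
    qed
  qed
  then obtain y where y: "X \<longlonglongrightarrow> y" using Cauchy_convergent convergent_def by blast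
  have yV: "y \<in> V" using V(1) X(1) y closed_sequentially by blast
  have "(\<lambda>n. J (X n)) \<longlonglongrightarrow> J y"
    unfolding J_def by (intro tendsto_intros y \<phi>.tendsto)
  moreover have "(\<lambda>n. m + 1 / Suc n) \<longlonglongrightarrow> m + 0"
    by (intro tendsto_intros LIMSEQ_Suc lim_1_over_n)
  ultimately have "J y \<le> m + 0"
    by (rule LIMSEQ_le) (use X(2) less_imp_le in blast)
  then have Jy: "J y \<le> J z" if "z \<in> V" for z using m_le[OF that] by linarith
  have "\<phi> z = inner y z" if z: "z \<in> V" for z
  proof -
    define d where "d = inner y z - \<phi> z"
    \<comment> \<open>First variation at the minimiser: the right-hand side is the increment of
      \<open>J\<close> from \<open>y\<close> to \<open>y + t *\<^sub>R z\<close>.\<close>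
    have quad: "0 \<le> 2 * t * d + t\<^sup>2 * (norm z)\<^sup>2" for t
    proof -
      have "y + t *\<^sub>R z \<in> V" using yV z V(2) by (simp add: subspace_add subspace_mul)
      from Jy[OF this] show ?thesis
        by (simp add: J_def d_def \<phi>.add \<phi>.scaleR power2_norm_eq_inner inner_simps inner_commute
            algebra_simps power2_eq_square[of t])
    qed
    have "d = 0"
    proof (rule ccontr)
      assume "d \<noteq> 0"
      \<comment> \<open>The choice \<open>t = - d / N\<close> makes the quadratic negative; the
        summand 1 keeps \<open>N\<close> positive when \<open>z = 0\<close>.\<close>
      define N where "N = (norm z)\<^sup>2 + 1"
      have N: "N > 0" "(norm z)\<^sup>2 \<le> N" by (auto simp: N_def add_nonneg_pos)
      have "0 \<le> 2 * (- d / N) * d + (- d / N)\<^sup>2 * (norm z)\<^sup>2" by (rule quad)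
      also have "\<dots> \<le> 2 * (- d / N) * d + (- d / N)\<^sup>2 * N"
        using N by (intro add_left_mono mult_left_mono) auto
      also have "\<dots> = - (d\<^sup>2 / N)" using N(1) by (simp add: field_simps power2_eq_square)
      also have "\<dots> < 0" using \<open>d \<noteq> 0\<close> N(1) by simp
      finally show False by simp
    qed
    then show ?thesis by (simp add: d_def)
  qed
  with yV show ?thesis using that by blast
qed

section \<open>Existence and properties of orthogonal projections\<close>

context
  fixes V :: "'a::chilbert set"
  assumes V: "closed_csubspace V"
begin

text \<open>\<open>V\<close> is stable under multiplication by \<open>\<i>\<close>, so real
  orthogonality to all of \<open>V\<close> already kills the imaginary parts.\<close>

lemma cinner_zero_iff_inner_zero:
  "(\<forall>z\<in>V. cinner x z = 0) \<longleftrightarrow> (\<forall>z\<in>V. inner x z = 0)"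
  using closed_csubspaceD(3)[OF V] by (auto simp: cinner_eq_Complex complex_eq_iff)

text \<open>Two candidates differ by a vector of \<open>V\<close> that is orthogonal to itself; this
  resolves the description in \<open>proj\<close>.\<close>

lemma proj_eqI:
  assumes "y \<in> V" "\<And>z. z \<in> V \<Longrightarrow> inner (x - y) z = 0"
  shows "proj V x = y"
  unfolding proj_def
proof (rule the_equality)
  show "y \<in> V \<and> (\<forall>z\<in>V. cinner (x - y) z = 0)"
    unfolding cinner_zero_iff_inner_zero using assms by blast
next
  fix y' assume "y' \<in> V \<and> (\<forall>z\<in>V. cinner (x - y') z = 0)"
  then have y': "y' \<in> V" "\<And>z. z \<in> V \<Longrightarrow> inner (x - y') z = 0"
    unfolding cinner_zero_iff_inner_zero by auto
  have "y' - y \<in> V" using y'(1) assms(1) closed_csubspaceD(2)[OF V] by (simp add: subspace_diff)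
  from assms(2)[OF this] y'(2)[OF this] have "inner (y' - y) (y' - y) = 0"
    by (simp add: inner_diff_left)
  then show "y' = y" by simp
qed

text \<open>Existence: the vector of \<open>V\<close> representing the functional
  \<open>inner x\<close> on \<open>V\<close> satisfies \<open>proj_eqI\<close>.\<close>

lemma proj_in [simp]: "proj V x \<in> V"
  and inner_diff_proj: "z \<in> V \<Longrightarrow> inner (x - proj V x) z = 0"
proof -
  obtain y where y: "y \<in> V" "\<And>z. z \<in> V \<Longrightarrow> inner x z = inner y z"
    using riesz_on_closed_subspace[OF closed_csubspaceD(1,2)[OF V] bounded_linear_inner_right]
    by metis
  then have "proj V x = y" by (intro proj_eqI) (auto simp: inner_diff_left)
  with y show "proj V x \<in> V" "z \<in> V \<Longrightarrow> inner (x - proj V x) z = 0"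
    by (auto simp: inner_diff_left)
qed

lemma inner_proj_left: "z \<in> V \<Longrightarrow> inner (proj V x) z = inner x z"
  using inner_diff_proj[of z x] by (simp add: inner_diff_left)

lemma proj_idem [simp]: "x \<in> V \<Longrightarrow> proj V x = x"
  by (rule proj_eqI) auto

lemma inner_proj: "inner (proj V x) y = inner x (proj V y)"
  by (metis inner_commute inner_proj_left proj_in)

lemma norm_proj_le: "norm (proj V x) \<le> norm x"
proof -
  have "(norm (proj V x))\<^sup>2 = inner x (proj V x)"
    by (simp add: power2_norm_eq_inner inner_proj_left)
  also have "\<dots> \<le> norm x * norm (proj V x)" by (rule norm_cauchy_schwarz)
  finally show ?thesis
    by (metis mult_right_le_imp_le norm_ge_zero norm_zero order_le_less power2_eq_square)
qed

lemma bounded_clinear_proj: "bounded_clinear (proj V)"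
  unfolding bounded_clinear_def
proof (intro conjI allI)
  show "bounded_linear (proj V)"
  proof (rule bounded_linear_intro[where K=1])
    fix x y r
    show "proj V (x + y) = proj V x + proj V y"
      using closed_csubspaceD(2)[OF V]
      by (intro proj_eqI) (auto simp: subspace_add inner_simps inner_proj_left)
    show "proj V (r *\<^sub>R x) = r *\<^sub>R proj V x"
      using closed_csubspaceD(2)[OF V]
      by (intro proj_eqI) (auto simp: subspace_mul inner_simps inner_proj_left)
  qed (use norm_proj_le in auto)
  fix c x
  show "proj V (c *\<^sub>C x) = c *\<^sub>C proj V x"
  proof (rule proj_eqI)
    show "c *\<^sub>C proj V x \<in> V" using V by (simp add: closed_csubspaceD(3))
    fix z assume "z \<in> V"
    moreover have "cinner (x - proj V x) z = 0" if "z \<in> V" for z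
      using that inner_diff_proj cinner_zero_iff_inner_zero by blast
    ultimately have "cinner (c *\<^sub>C (x - proj V x)) z = 0" by (simp add: cinner_scaleC_left)
    then show "inner (c *\<^sub>C x - c *\<^sub>C proj V x) z = 0"
      by (simp add: inner_eq_Re_cinner bounded_linear_scaleC bounded_linear.linear linear_diff)
  qed
qed

end

lemma bounded_linear_proj: "closed_csubspace V \<Longrightarrow> bounded_linear (proj V)"
  using bounded_clinear_proj unfolding bounded_clinear_def by blast

text \<open>Riesz on the whole space gives the real adjoint. Complex linearity of \<open>T\<close>
  makes it the complex adjoint, and nondegeneracy makes it the only one.\<close>

lemma inner_cadjoint:
  assumes T: "bounded_clinear (T :: 'a::chilbert \<Rightarrow> 'b::chilbert)"
  shows "inner (cadjoint T y) x = inner y (T x)"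
proof -
  have bl: "bounded_linear T" and sc: "\<And>c x. T (c *\<^sub>C x) = c *\<^sub>C T x"
    using T by (auto simp: bounded_clinear_def)
  have "\<exists>u. \<forall>x. inner y (T x) = inner u x" for y
    using riesz_on_closed_subspace[of UNIV "\<lambda>x. inner y (T x)"]
      bounded_linear_compose[OF bounded_linear_inner_right[of y] bl]
    by (metis closed_UNIV subspace_UNIV UNIV_I)
  then obtain U where U: "\<And>y x. inner y (T x) = inner (U y) x" by metis
  have *: "cinner (T x) y = cinner x (U y)" for x y
  proof -
    have "cinner y (T x) = cinner (U y) x"
      by (simp add: cinner_eq_Complex U flip: sc)
    then show ?thesis by (metis cinner_commute)
  qed
  have "cadjoint T = U"
    unfolding cadjoint_def
  proof (rule the_equality)
    fix U' assume "\<forall>x y. cinner (T x) y = cinner x (U' y)"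
    then have "inner x (U' y) = inner x (U y)" for x y by (simp add: inner_eq_Re_cinner *)
    then show "U' = U" by (metis ext vector_eq_rdot inner_commute)
  qed (simp add: *)
  with U show ?thesis by metis
qed

section \<open>Coercive operators\<close>

text \<open>The setting of Lax-Milgram on a closed subspace. Everything is stated on
  \<open>V\<close> only, so that frame operators on \<open>K w\<close>, compressions to subspaces
  and Gram operators are all instances.\<close>

locale coercive_on =
  fixes V :: "'a::{real_inner, banach} set" and T :: "'a \<Rightarrow> 'a" and b c :: real
  assumes V: "closed V" "subspace V"
    and maps: "x \<in> V \<Longrightarrow> T x \<in> V"
    and diff: "x \<in> V \<Longrightarrow> y \<in> V \<Longrightarrow> T (x - y) = T x - T y"
    and upper: "x \<in> V \<Longrightarrow> norm (T x) \<le> b * norm x"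
    and lower: "x \<in> V \<Longrightarrow> c * (norm x)\<^sup>2 \<le> inner (T x) x"
    and cb: "0 < c" "c \<le> b"
begin

text \<open>Richardson iteration with step size \<open>c / b\<^sup>2\<close>, for which it is a contraction.\<close>

definition step :: "'a \<Rightarrow> 'a \<Rightarrow> 'a" where
  "step y x = x - (c / b\<^sup>2) *\<^sub>R (T x - y)"

text \<open>With \<open>t = c / b^2\<close> the factor \<open>1 - 2 * t * c + t^2 * b^2\<close>
  takes its least value \<open>1 - c^2 / b^2\<close>.\<close>

definition rate :: real where
  "rate = sqrt (1 - c\<^sup>2 / b\<^sup>2)"

lemma rate: "0 \<le> rate" "rate < 1" "rate\<^sup>2 = 1 - c\<^sup>2 / b\<^sup>2"
proof -
  have "c\<^sup>2 \<le> b\<^sup>2" "0 < b" using cb by (auto intro: power_mono)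
  then have "c\<^sup>2 / b\<^sup>2 \<le> 1" "0 < c\<^sup>2 / b\<^sup>2" using cb by auto
  then show "0 \<le> rate" "rate < 1" "rate\<^sup>2 = 1 - c\<^sup>2 / b\<^sup>2" by (auto simp: rate_def)
qed

lemma step_in: "x \<in> V \<Longrightarrow> y \<in> V \<Longrightarrow> step y x \<in> V"
  using V(2) maps by (simp add: step_def subspace_diff subspace_mul)

text \<open>Expand the square; coercivity controls the cross term and the norm bound controls the
  quadratic one.\<close>

lemma step_contraction:
  assumes "x \<in> V" "x' \<in> V"
  shows "norm (step y x - step y x') \<le> rate * norm (x - x')"
proof -
  define d where "d = x - x'"
  have d: "d \<in> V" using assms V(2) by (simp add: d_def subspace_diff)
  define t where "t = c / b\<^sup>2"
  have b: "b > 0" and t: "t > 0" using cb by (auto simp: t_def)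
  have "step y x - step y x' = d - t *\<^sub>R T d"
    using assms by (simp add: step_def d_def t_def diff algebra_simps)
  then have "(norm (step y x - step y x'))\<^sup>2
      = (norm d)\<^sup>2 - 2 * t * inner (T d) d + t\<^sup>2 * (norm (T d))\<^sup>2"
    by (simp add: power2_norm_eq_inner inner_simps inner_commute power2_eq_square[of t])
  also have "\<dots> \<le> (norm d)\<^sup>2 - 2 * t * (c * (norm d)\<^sup>2) + t\<^sup>2 * (b * norm d)\<^sup>2"
    using lower[OF d] upper[OF d] t
    by (intro add_mono diff_mono mult_left_mono power_mono) auto
  also have "\<dots> = (rate * norm d)\<^sup>2"
    unfolding power_mult_distrib rate(3) using b
    by (simp add: t_def field_simps power2_eq_square)
  finally show ?thesis
    unfolding d_def by (rule power2_le_imp_le) (simp add: rate(1))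
qed

lemma lower_norm: "x \<in> V \<Longrightarrow> c * norm x \<le> norm (T x)"
proof (cases "x = 0")
  case False
  assume "x \<in> V"
  then have "c * norm x * norm x \<le> norm (T x) * norm x"
    using lower[of x] norm_cauchy_schwarz[of "T x" x] by (simp add: power2_eq_square mult.assoc)
  with False show ?thesis by simp
qed simp

lemma inj: "inj_on T V"
proof (rule inj_onI)
  fix x y assume "x \<in> V" "y \<in> V" "T x = T y"
  then have "c * norm (x - y) \<le> 0"
    using lower_norm[of "x - y"] V(2) by (simp add: diff subspace_diff)
  then show "x = y" using cb(1) by (simp add: mult_le_0_iff)
qed

lemma step_fixed_iff: "step y x = x \<longleftrightarrow> T x = y"
  using cb by (auto simp: step_def)

text \<open>Surjectivity is Banach's fixed point theorem on the complete set \<open>V\<close>: fixed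
  points of \<open>step y\<close> are preimages of \<open>y\<close>.\<close>

lemma bij: "bij_betw T V V"
  unfolding bij_betw_def
proof (intro conjI equalityI subsetI inj)
  fix y assume y: "y \<in> V"
  have "\<exists>!x\<in>V. step y x = x"
    by (rule Banach_fix[where c=rate])
      (use V y rate step_in step_contraction in \<open>auto simp: complete_eq_closed dist_norm dest: subspace_0\<close>)
  then show "y \<in> T ` V" by (auto simp: step_fixed_iff)
qed (use maps in auto)

text \<open>An explicit approximation of the solution; it later shows that solutions depend
  measurably on a parameter.\<close>

lemma iterates_tendsto:
  assumes "x \<in> V" "T x = y"
  shows "(\<lambda>n. (step y ^^ n) 0) \<longlonglongrightarrow> x"
proof -
  have y: "y \<in> V" using assms maps by auto
  have it: "(step y ^^ n) 0 \<in> V" for n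
    by (induction n) (auto simp: step_in y V(2) subspace_0)
  have "norm ((step y ^^ n) 0 - x) \<le> rate ^ n * norm x" for n
  proof (induction n)
    case (Suc n)
    have "norm ((step y ^^ Suc n) 0 - x) = norm (step y ((step y ^^ n) 0) - step y x)"
      using assms by (simp add: step_fixed_iff[THEN iffD2])
    also have "\<dots> \<le> rate * norm ((step y ^^ n) 0 - x)"
      by (rule step_contraction) (use it assms in auto)
    also have "\<dots> \<le> rate * (rate ^ n * norm x)"
      using Suc rate(1) by (intro mult_left_mono) auto
    finally show ?case by simp
  qed simp
  moreover have "(\<lambda>n. rate ^ n * norm x) \<longlonglongrightarrow> 0 * norm x"
    using rate by (intro tendsto_mult LIMSEQ_realpow_zero tendsto_const) auto
  ultimately have "(\<lambda>n. (step y ^^ n) 0 - x) \<longlonglongrightarrow> 0"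
    by (auto intro: Lim_null_comparison[of _ "\<lambda>n. rate ^ n * norm x"])
  then show ?thesis by (simp add: LIM_zero_iff)
qed

end

section \<open>Inverses of positive operators and images of subspaces\<close>

text \<open>The abstract form of a frame operator on its space: \<open>b\<close> is the upper bound,
  \<open>c\<close> the lower one.\<close>

locale positive_on = coercive_on K S b c
  for K :: "'a::chilbert set" and S b c +
  assumes K: "closed_csubspace K"
    and scaleC: "x \<in> K \<Longrightarrow> S (r *\<^sub>C x) = r *\<^sub>C S x"
    and selfadjoint: "x \<in> K \<Longrightarrow> y \<in> K \<Longrightarrow> inner (S x) y = inner x (S y)"
begin

abbreviation T :: "'a \<Rightarrow> 'a" where
  "T \<equiv> inv_into K S"

lemma T_in [simp]: "y \<in> K \<Longrightarrow> T y \<in> K"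
  and S_T [simp]: "y \<in> K \<Longrightarrow> S (T y) = y"
  and T_S [simp]: "y \<in> K \<Longrightarrow> T (S y) = y"
  using bij by (auto simp: bij_betw_def inv_into_into f_inv_into_f)

lemma T_eqI: "x \<in> K \<Longrightarrow> S x = y \<Longrightarrow> T y = x"
  by auto

lemma T_diff: "x \<in> K \<Longrightarrow> y \<in> K \<Longrightarrow> T (x - y) = T x - T y"
  by (rule T_eqI) (auto simp: diff V(2) subspace_diff)

lemma T_scaleC: "x \<in> K \<Longrightarrow> T (r *\<^sub>C x) = r *\<^sub>C T x"
  by (rule T_eqI) (auto simp: scaleC K closed_csubspaceD(3))

lemma T_selfadjoint: "x \<in> K \<Longrightarrow> y \<in> K \<Longrightarrow> inner (T x) y = inner x (T y)"
  using selfadjoint[of "T x" "T y"] by simp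

lemma norm_T_le: "y \<in> K \<Longrightarrow> norm (T y) \<le> norm y / c"
  using lower_norm[of "T y"] cb by (simp add: field_simps)

lemma norm_T_ge: "y \<in> K \<Longrightarrow> norm y / b \<le> norm (T y)"
  using upper[of "T y"] cb by (simp add: field_simps)

text \<open>\<open>S\<close> and its inverse are controlled only on \<open>K\<close>. Precomposing
  with \<open>proj K\<close> gives bounded linear maps on the whole space, to which continuity and
  measurability results apply.\<close>

lemma bounded_linear_proj_on:
  assumes "\<And>x. x \<in> K \<Longrightarrow> norm (L x) \<le> d * norm x" "0 \<le> d"
    and "\<And>x r. x \<in> K \<Longrightarrow> L (r *\<^sub>C x) = r *\<^sub>C L x"
    and "\<And>x y. x \<in> K \<Longrightarrow> y \<in> K \<Longrightarrow> L (x - y) = L x - (L y :: 'a)"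
  shows "bounded_linear (\<lambda>x. L (proj K x))"
proof (rule bounded_linear_intro[where K=d])
  interpret P: bounded_linear "proj K" using K by (rule bounded_linear_proj)
  \<comment> \<open>Only differences are known to be preserved; sums follow once negation is treated
    as the scalar -1.\<close>
  have neg: "L (- x) = - L x" if "x \<in> K" for x
  proof -
    have "r *\<^sub>C x = - x" if "r = complex_of_real (- 1)" for r and x :: 'a
      unfolding that scaleC_of_real by simp
    with assms(3)[OF that] show ?thesis by metis
  qed
  fix x y r
  have "L (proj K x - - proj K y) = L (proj K x) - L (- proj K y)"
    using K V(2) by (intro assms(4)) (auto simp: subspace_neg)
  then show "L (proj K (x + y)) = L (proj K x) + L (proj K y)"
    using K by (simp add: P.add neg)
  show "L (proj K (r *\<^sub>R x)) = r *\<^sub>R L (proj K x)"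
    using assms(3)[OF proj_in[OF K], of "complex_of_real r" x] by (simp add: P.scaleR scaleC_of_real)
  have "norm (L (proj K x)) \<le> d * norm (proj K x)" using K by (intro assms) auto
  also have "\<dots> \<le> d * norm x" using assms(2) norm_proj_le[OF K] by (intro mult_left_mono)
  finally show "norm (L (proj K x)) \<le> norm x * d" by (simp add: mult.commute)
qed

lemma bounded_linear_T_proj: "bounded_linear (\<lambda>x. T (proj K x))"
  using bounded_linear_proj_on[of T "1 / c"] norm_T_le cb T_scaleC T_diff by simp

lemma bounded_linear_S_proj: "bounded_linear (\<lambda>x. S (proj K x))"
  using bounded_linear_proj_on[of S b] upper cb scaleC diff by simp

lemma bounded_clinear_T_comp:
  assumes "bounded_clinear L" "\<And>x. L x \<in> K"
  shows "bounded_clinear (\<lambda>x. T (L x))"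
proof -
  have "bounded_linear (\<lambda>x. T (proj K (L x)))"
    using assms(1) bounded_linear_compose[OF bounded_linear_T_proj, of L]
    by (simp add: bounded_clinear_def)
  then show ?thesis
    using assms K by (simp add: bounded_clinear_def T_scaleC)
qed

lemma measurable_T:
  assumes "f \<in> borel_measurable N" "\<And>x. x \<in> space N \<Longrightarrow> f x \<in> K"
  shows "(\<lambda>x. T (f x)) \<in> borel_measurable N"
proof -
  have "(\<lambda>x. T (proj K (f x))) \<in> borel_measurable N"
    using bounded_linear.continuous_on[OF bounded_linear_T_proj continuous_on_id] assms(1)
    by (intro borel_measurable_continuous_on[of "\<lambda>x. T (proj K x)"]) auto
  then show ?thesis
    using assms(2) K by (subst measurable_cong[where g="\<lambda>x. T (proj K (f x))"]) auto
qed

text \<open>Closedness comes from writing the image as a preimage under the continuous map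
  \<open>S \<circ> proj K\<close>, linearity from writing it as an image under
  \<open>T \<circ> proj K\<close>.\<close>

lemma closed_csubspace_image_T:
  assumes V: "closed_csubspace V" "V \<subseteq> K"
  shows "closed_csubspace (T ` V)"
  unfolding closed_csubspace_def
proof (intro conjI allI ballI)
  have "T ` V = K \<inter> (\<lambda>x. S (proj K x)) -` V"
  proof (intro set_eqI iffI)
    fix x assume "x \<in> K \<inter> (\<lambda>x. S (proj K x)) -` V"
    then have "x \<in> K" "S x \<in> V" using K by auto
    then show "x \<in> T ` V" by (metis T_S imageI)
  qed (use V K in auto)
  moreover have "closed ((\<lambda>x. S (proj K x)) -` V)"
    using bounded_linear.continuous_on[OF bounded_linear_S_proj continuous_on_id, of UNIV]
      closed_csubspaceD(1)[OF V(1)]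
    by (intro continuous_closed_vimage) (auto simp: continuous_on_eq_continuous_at)
  ultimately show "closed (T ` V)" using closed_csubspaceD(1)[OF K] by auto
  have "T ` V = (\<lambda>x. T (proj K x)) ` V" using V K by (auto simp: subset_iff image_iff)
  then show "subspace (T ` V)"
    using linear_subspace_image bounded_linear.linear[OF bounded_linear_T_proj]
      closed_csubspaceD(2)[OF V(1)] by metis
  fix r x assume "x \<in> T ` V"
  then obtain u where u: "u \<in> V" "x = T u" by auto
  then have "r *\<^sub>C x = T (r *\<^sub>C u)" using V(2) by (simp add: T_scaleC subsetD)
  then show "r *\<^sub>C x \<in> T ` V" using closed_csubspaceD(3)[OF V(1) u(1)] by blast
qed

section \<open>Least-squares description of projections onto images of subspaces\<close>

context
  fixes V
  assumes V': "closed_csubspace V" "V \<subseteq> K"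
begin

text \<open>Since \<open>T\<close> is self-adjoint, the quadratic form of this map on
  \<open>V\<close> is the squared norm of \<open>T x\<close>. The two-sided bounds on
  \<open>T\<close> therefore make the normal equations uniquely solvable.\<close>

lemma compression_coercive: "coercive_on V (\<lambda>u. proj V (T (T u))) (1 / c\<^sup>2) (1 / b\<^sup>2)"
proof
  show "closed V" "subspace V" using V' by (auto simp: closed_csubspaceD)
  show "0 < 1 / b\<^sup>2" using cb by simp
  show "1 / b\<^sup>2 \<le> 1 / c\<^sup>2" using cb by (intro divide_left_mono power_mono) auto
next
  fix x y assume x: "x \<in> V"
  show "proj V (T (T x)) \<in> V" using V' by simp
  have xK: "x \<in> K" using x V' by auto
  have "norm (proj V (T (T x))) \<le> norm (T (T x))" using V' by (intro norm_proj_le)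
  also have "\<dots> \<le> norm (T x) / c" using xK by (intro norm_T_le) auto
  also have "\<dots> \<le> (norm x / c) / c" using xK norm_T_le cb by (intro divide_right_mono) auto
  finally show "norm (proj V (T (T x))) \<le> 1 / c\<^sup>2 * norm x" by (simp add: power2_eq_square)
  have "1 / b\<^sup>2 * (norm x)\<^sup>2 = (norm x / b)\<^sup>2" by (simp add: power_divide)
  also have "\<dots> \<le> (norm (T x))\<^sup>2" using norm_T_ge[OF xK] cb by (intro power_mono) auto
  also have "\<dots> = inner (proj V (T (T x))) x"
    using V' x xK by (simp add: inner_proj_left T_selfadjoint power2_norm_eq_inner)
  finally show "1 / b\<^sup>2 * (norm x)\<^sup>2 \<le> inner (proj V (T (T x))) x" .
  assume y: "y \<in> V"
  show "proj V (T (T (x - y))) = proj V (T (T x)) - proj V (T (T y))"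
    using x y V' bounded_linear.linear[OF bounded_linear_proj[OF V'(1)]]
    by (auto simp: T_diff linear_diff subset_iff)
qed

text \<open>The normal equations of minimising \<open>\<parallel>y - T u\<parallel>\<close> over \<open>u \<in> V\<close>.\<close>

lemma proj_image_T:
  assumes y: "y \<in> K" and u: "u \<in> V" "proj V (T (T u)) = proj V (T y)"
  shows "proj (T ` V) y = T u"
proof (rule proj_eqI[OF closed_csubspace_image_T[OF V']])
  fix z assume "z \<in> T ` V"
  then obtain x where x: "x \<in> V" "z = T x" by auto
  have "inner (y - T u) z = inner (T y) x - inner (T (T u)) x"
    using x y u V' by (auto simp: inner_diff_left T_selfadjoint subset_iff)
  also have "\<dots> = 0"
    using u(2) x V' by (metis inner_proj_left diff_self)
  finally show "inner (y - T u) z = 0" .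
qed (use u in auto)

end

end

text \<open>Replace \<open>x\<close> by simple functions: each takes finitely many values, so the
  composition is measurable. Continuity of \<open>G v\<close> allows the limit.\<close>

lemma measurable_caratheodory:
  fixes G :: "'v \<Rightarrow> 'a::{metric_space, second_countable_topology} \<Rightarrow> 'b::metric_space"
  assumes G: "\<And>x. (\<lambda>v. G v x) \<in> borel_measurable M"
    and cont: "\<And>v. v \<in> space M \<Longrightarrow> continuous_on UNIV (G v)"
    and x: "x \<in> borel_measurable M"
  shows "(\<lambda>v. G v (x v)) \<in> borel_measurable M"
proof -
  obtain F where F: "\<And>i. simple_function M (F i)"
      "\<And>v. v \<in> space M \<Longrightarrow> (\<lambda>i. F i v) \<longlonglongrightarrow> x v"
    using borel_measurable_implies_sequence_metric[OF x] by metis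
  show ?thesis
  proof (rule borel_measurable_LIMSEQ_metric)
    fix i
    have fin: "finite (F i ` space M)" using F(1) by (rule simple_functionD)
    have "F i \<in> measurable M (count_space (F i ` space M))"
      using simple_functionD(2)[OF F(1)[of i]] unfolding measurable_count_space_eq2[OF fin] by blast
    with G show "(\<lambda>v. G v (F i v)) \<in> borel_measurable M"
      by (rule measurable_compose_countable') (use fin in \<open>rule countable_finite\<close>)
  next
    fix v assume "v \<in> space M"
    with F(2) cont show "(\<lambda>i. G v (F i v)) \<longlonglongrightarrow> G v (x v)"
      by (intro continuous_on_tendsto_compose[where s=UNIV and f="G v"]) auto
  qed
qed

lemma measurable_proj_image_inv_into:
  fixes K :: "'a::{chilbert, second_countable_topology} set" and V :: "'v \<Rightarrow> 'a set"
  assumes S: "positive_on K S b c"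
    and Vs: "\<And>v. v \<in> space N \<Longrightarrow> closed_csubspace (V v) \<and> V v \<subseteq> K"
    and meas: "\<And>f. f \<in> K \<Longrightarrow> (\<lambda>v. proj (V v) f) \<in> borel_measurable N"
    and y: "y \<in> K"
  shows "(\<lambda>v. proj (inv_into K S ` V v) y) \<in> borel_measurable N"
proof -
  interpret positive_on K S b c by fact
  define C where "C v u = proj (V v) (T (T u))" for v u
  \<comment> \<open>Richardson iterates for the normal equations, started at 0.\<close>
  define u where "u v n = (coercive_on.step (C v) (1 / c\<^sup>2) (1 / b\<^sup>2) (proj (V v) (T y)) ^^ n) 0" for v n
  have coer: "coercive_on (V v) (C v) (1 / c\<^sup>2) (1 / b\<^sup>2)" if "v \<in> space N" for v
    unfolding C_def using Vs[OF that] compression_coercive by auto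
  have uV: "u v n \<in> V v" if "v \<in> space N" for v n
    using Vs[OF that] coercive_on.step_in[OF coer[OF that]]
    by (induction n) (auto simp: u_def closed_csubspaceD subspace_0)
  have uK: "u v n \<in> K" if "v \<in> space N" for v n using that uV Vs by blast
  \<comment> \<open>\<open>meas\<close> covers fixed vectors of \<open>K\<close>; inserting
    \<open>proj K\<close> yields a function defined on the whole space, continuous in the vector, so
    that the argument may vary with \<open>v\<close>.\<close>
  have proj_meas: "(\<lambda>v. proj (V v) (x v)) \<in> borel_measurable N"
    if x: "x \<in> borel_measurable N" "\<And>v. v \<in> space N \<Longrightarrow> x v \<in> K" for x
  proof -
    have "(\<lambda>v. proj (V v) (proj K (x v))) \<in> borel_measurable N"
    proof (rule measurable_caratheodory[OF _ _ x(1)])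
      show "(\<lambda>v. proj (V v) (proj K z)) \<in> borel_measurable N" for z using meas K by simp
      fix v assume "v \<in> space N"
      then show "continuous_on UNIV (\<lambda>z. proj (V v) (proj K z))"
        using Vs K bounded_linear_compose[OF bounded_linear_proj bounded_linear_proj]
        by (intro bounded_linear.continuous_on[of _ UNIV "\<lambda>z. z", OF _ continuous_on_id]) auto
    qed
    then show ?thesis
      using x(2) K by (subst measurable_cong[where g="\<lambda>v. proj (V v) (proj K (x v))"]) auto
  qed
  have u_meas: "(\<lambda>v. u v n) \<in> borel_measurable N" for n
  proof (induction n)
    case (Suc n)
    have "(\<lambda>v. C v (u v n)) \<in> borel_measurable N"
      unfolding C_def using uK Suc by (intro proj_meas measurable_T) auto
    moreover have "(\<lambda>v. proj (V v) (T y)) \<in> borel_measurable N" using y by (intro meas) auto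
    \<comment> \<open>The scalar is the step size of \<open>coercive_on\<close> with upper bound
      \<open>1 / c^2\<close> and lower bound \<open>1 / b^2\<close>.\<close>
    ultimately have "(\<lambda>v. u v n - (1 / b\<^sup>2 / (1 / c\<^sup>2)\<^sup>2) *\<^sub>R (C v (u v n) - proj (V v) (T y)))
        \<in> borel_measurable N"
      using Suc by measurable
    then show ?case
      by (rule measurable_cong[THEN iffD1, rotated])
        (simp add: u_def coercive_on.step_def[OF coer])
  qed (simp add: u_def)
  \<comment> \<open>The iterates tend to the exact solution \<open>x\<close> of the normal
    equations, and \<open>T x\<close> is the projection sought.\<close>
  have lim: "(\<lambda>n. T (u v n)) \<longlonglongrightarrow> proj (T ` V v) y" if v: "v \<in> space N" for v
  proof -
    interpret C: coercive_on "V v" "C v" "1 / c\<^sup>2" "1 / b\<^sup>2" using v by (rule coer)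
    have Vv: "closed_csubspace (V v)" "V v \<subseteq> K" using Vs v by auto
    obtain x where x: "x \<in> V v" "C v x = proj (V v) (T y)"
      using C.bij proj_in[OF Vv(1)] unfolding bij_betw_def by (metis imageE)
    have "(\<lambda>n. u v n) \<longlonglongrightarrow> x"
      unfolding u_def by (rule C.iterates_tendsto[OF x])
    from bounded_linear.tendsto[OF bounded_linear_T_proj this]
    have "(\<lambda>n. T (u v n)) \<longlonglongrightarrow> T x"
      using uV[OF v] Vv(2) x(1) K by (auto simp: subset_iff)
    with proj_image_T[OF Vv y x(1)] x(2) show ?thesis by (simp add: C_def)
  qed
  show ?thesis
    using lim uK by (intro borel_measurable_LIMSEQ_metric[OF measurable_T[OF u_meas]]) auto
qed

section \<open>Frame operators\<close>

context
  fixes I :: "'i set" and e :: "'i \<Rightarrow> 'k::chilbert" and K A B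
  assumes frame: "frame_for I e K A B" and K: "closed_csubspace K"
begin

lemma frame_bounds: "0 < A" "A \<le> B" "0 < B"
  and frame_in: "i \<in> I \<Longrightarrow> e i \<in> K"
  using frame by (auto simp: frame_for_def)

lemma frame_coeff:
  assumes "x \<in> K"
  shows "(\<lambda>i. (cmod (cinner x (e i)))\<^sup>2) summable_on I"
    "A * (norm x)\<^sup>2 \<le> (\<Sum>\<^sub>\<infinity>i\<in>I. (cmod (cinner x (e i)))\<^sup>2)"
    "(\<Sum>\<^sub>\<infinity>i\<in>I. (cmod (cinner x (e i)))\<^sup>2) \<le> B * (norm x)\<^sup>2"
  using frame assms by (auto simp: frame_for_def)

lemma frame_coeff_finite:
  assumes "x \<in> K" "finite F" "F \<subseteq> I"
  shows "(\<Sum>i\<in>F. (cmod (cinner x (e i)))\<^sup>2) \<le> B * (norm x)\<^sup>2"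
proof -
  have "(\<Sum>i\<in>F. (cmod (cinner x (e i)))\<^sup>2) \<le> (\<Sum>\<^sub>\<infinity>i\<in>I. (cmod (cinner x (e i)))\<^sup>2)"
    using assms by (intro finite_sum_le_infsum frame_coeff) auto
  with frame_coeff(3)[OF assms(1)] show ?thesis by linarith
qed

text \<open>The synthesis bound dual to Bessel's inequality, found by pairing the sum with
  itself.\<close>

lemma norm_synthesis_le:
  assumes F: "finite F" "F \<subseteq> I"
  shows "(norm (\<Sum>i\<in>F. a i *\<^sub>C e i))\<^sup>2 \<le> B * (\<Sum>i\<in>F. (cmod (a i))\<^sup>2)"
proof -
  define s where "s = (\<Sum>i\<in>F. a i *\<^sub>C e i)"
  have s: "s \<in> K"
    unfolding s_def using F frame_in K closed_csubspaceD(2,3)[OF K]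
    by (intro subspace_sum) auto
  have "(norm s)\<^sup>2 = (\<Sum>i\<in>F. inner (a i *\<^sub>C e i) s)"
    by (simp add: power2_norm_eq_inner s_def inner_sum_left)
  \<comment> \<open>Young's inequality with weight \<open>B\<close>: after Bessel the second terms
    add up to at most half of \<open>(norm s)^2\<close>, which is absorbed on the left.\<close>
  also have "\<dots> \<le> (\<Sum>i\<in>F. B / 2 * (cmod (a i))\<^sup>2 + (cmod (cinner s (e i)))\<^sup>2 / (2 * B))"
  proof (rule sum_mono)
    fix i
    define p q where "p = cmod (a i)" and "q = cmod (cinner s (e i))"
    have "inner (a i *\<^sub>C e i) s = Re (a i * cinner (e i) s)"
      by (simp add: inner_eq_Re_cinner cinner_scaleC_left)
    also have "\<dots> \<le> p * q"
      unfolding p_def q_def using complex_Re_le_cmod[of "a i * cinner (e i) s"]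
      by (simp add: norm_mult) (metis cinner_commute complex_mod_cnj)
    also have "\<dots> \<le> B / 2 * p\<^sup>2 + q\<^sup>2 / (2 * B)"
    proof -
      have "0 \<le> (B * p - q)\<^sup>2 / (2 * B)" using frame_bounds by simp
      also have "\<dots> = B / 2 * p\<^sup>2 + q\<^sup>2 / (2 * B) - p * q"
        using frame_bounds by (simp add: field_simps power2_eq_square)
      finally show ?thesis by simp
    qed
    finally show "inner (a i *\<^sub>C e i) s \<le> B / 2 * (cmod (a i))\<^sup>2 + (cmod (cinner s (e i)))\<^sup>2 / (2 * B)"
      by (simp add: p_def q_def)
  qed
  also have "\<dots> = B / 2 * (\<Sum>i\<in>F. (cmod (a i))\<^sup>2) + (\<Sum>i\<in>F. (cmod (cinner s (e i)))\<^sup>2) / (2 * B)"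
    by (simp add: sum.distrib sum_distrib_left sum_divide_distrib)
  also have "\<dots> \<le> B / 2 * (\<Sum>i\<in>F. (cmod (a i))\<^sup>2) + (B * (norm s)\<^sup>2) / (2 * B)"
    using frame_bounds s F by (intro add_left_mono divide_right_mono frame_coeff_finite) auto
  also have "(B * (norm s)\<^sup>2) / (2 * B) = (norm s)\<^sup>2 / 2" using frame_bounds by simp
  finally show ?thesis by (simp add: s_def)
qed

text \<open>\<open>infsum\<close> defaults to 0 without convergence, so convergence has to be
  established. Tails of the coefficient sum are small, and the synthesis bound transfers this to the
  vectors.\<close>

lemma frame_operator_has_sum:
  assumes x: "x \<in> K"
  shows "((\<lambda>i. cinner x (e i) *\<^sub>C e i) has_sum frame_operator I e x) I"
proof -
  let ?f = "\<lambda>i. cinner x (e i) *\<^sub>C e i" and ?g = "\<lambda>i. (cmod (cinner x (e i)))\<^sup>2"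
  note sg = frame_coeff(1)[OF x]
  have small: "\<exists>F0. finite F0 \<and> F0 \<subseteq> I \<and> (\<forall>F. finite F \<longrightarrow> F \<subseteq> I - F0 \<longrightarrow> norm (sum ?f F) < \<epsilon>)"
    if eps: "\<epsilon> > 0" for \<epsilon>
  proof -
    have "0 < \<epsilon>\<^sup>2 / B" using eps frame_bounds by simp
    with infsum_tendsto[OF sg] have "eventually (\<lambda>F. dist (sum ?g F) (infsum ?g I) < \<epsilon>\<^sup>2 / B)
        (finite_subsets_at_top I)" by (simp add: tendsto_iff)
    then obtain F0 where F0: "finite F0" "F0 \<subseteq> I" "dist (sum ?g F0) (infsum ?g I) < \<epsilon>\<^sup>2 / B"
      unfolding eventually_finite_subsets_at_top by blast
    have "norm (sum ?f F) < \<epsilon>" if F: "finite F" "F \<subseteq> I - F0" for F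
    proof -
      have "sum ?g F0 + sum ?g F = sum ?g (F0 \<union> F)"
        using F F0 by (intro sum.union_disjoint[symmetric]) auto
      also have "\<dots> \<le> infsum ?g I"
        using F F0 by (intro finite_sum_le_infsum sg) auto
      finally have "sum ?g F < \<epsilon>\<^sup>2 / B" using F0(3) by (simp add: dist_real_def)
      then have "B * sum ?g F < \<epsilon>\<^sup>2" using frame_bounds by (simp add: field_simps)
      then have "(norm (sum ?f F))\<^sup>2 < \<epsilon>\<^sup>2"
        using norm_synthesis_le[of F "\<lambda>i. cinner x (e i)"] F by (auto simp: subset_iff)
      with eps show ?thesis by (simp add: power_less_imp_less_base)
    qed
    with F0 show ?thesis by blast
  qed
  have "cauchy_filter (filtermap (sum ?f) (finite_subsets_at_top I))"
    unfolding cauchy_filter_metric_filtermap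
  proof (intro allI impI)
    fix \<epsilon> :: real assume "\<epsilon> > 0"
    then obtain F0 where F0: "finite F0" "F0 \<subseteq> I"
      "\<And>F. finite F \<Longrightarrow> F \<subseteq> I - F0 \<Longrightarrow> norm (sum ?f F) < \<epsilon> / 2" using small[of "\<epsilon> / 2"] by auto
    show "\<exists>P. eventually P (finite_subsets_at_top I) \<and>
        (\<forall>Y Z. P Y \<and> P Z \<longrightarrow> dist (sum ?f Y) (sum ?f Z) < \<epsilon>)"
    proof (intro exI[of _ "\<lambda>F. finite F \<and> F0 \<subseteq> F \<and> F \<subseteq> I"] conjI allI impI)
      show "\<forall>\<^sub>F F in finite_subsets_at_top I. finite F \<and> F0 \<subseteq> F \<and> F \<subseteq> I"
        using F0 unfolding eventually_finite_subsets_at_top by blast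
      fix Y Z assume YZ: "(finite Y \<and> F0 \<subseteq> Y \<and> Y \<subseteq> I) \<and> (finite Z \<and> F0 \<subseteq> Z \<and> Z \<subseteq> I)"
      \<comment> \<open>The common part \<open>F0\<close> cancels, leaving two tails of norm below
        half of \<epsilon>.\<close>
      have "sum ?f Y - sum ?f Z = sum ?f (Y - F0) - sum ?f (Z - F0)"
        using YZ by (simp add: sum_diff)
      then have "dist (sum ?f Y) (sum ?f Z) \<le> norm (sum ?f (Y - F0)) + norm (sum ?f (Z - F0))"
        by (simp add: dist_norm norm_triangle_ineq4)
      moreover have "norm (sum ?f (Y - F0)) < \<epsilon> / 2" "norm (sum ?f (Z - F0)) < \<epsilon> / 2"
        using YZ F0(3)[of "Y - F0"] F0(3)[of "Z - F0"] by auto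
      ultimately show "dist (sum ?f Y) (sum ?f Z) < \<epsilon>" by linarith
    qed
  qed
  then obtain l where "filtermap (sum ?f) (finite_subsets_at_top I) \<le> nhds l"
    using cauchy_filter_convergent convergent_filter_iff by blast
  then have "(?f has_sum l) I" by (simp add: has_sum_def filterlim_def)
  then show ?thesis by (simp add: frame_operator_def infsumI)
qed

text \<open>Exchanging \<open>x\<close> and \<open>y\<close> conjugates the summand, which gives
  self-adjointness; \<open>y = x\<close> gives the frame sum.\<close>

lemma frame_operator_inner_has_sum:
  assumes "x \<in> K"
  shows "((\<lambda>i. Re (cinner x (e i) * cnj (cinner y (e i)))) has_sum inner (frame_operator I e x) y) I"
proof -
  have "inner (cinner x (e i) *\<^sub>C e i) y = Re (cinner x (e i) * cnj (cinner y (e i)))" for i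
    by (simp add: inner_eq_Re_cinner cinner_scaleC_left flip: cinner_commute)
  with has_sum_bounded_linear[OF bounded_linear_inner_left frame_operator_has_sum[OF assms], of y]
  show ?thesis by simp
qed

text \<open>Coercivity is the lower frame inequality. The norm bound combines the synthesis bound
  with Bessel on finite sums and passes to the limit.\<close>

lemma frame_operator_positive_on: "positive_on K (frame_operator I e) B A"
proof
  fix x assume x: "x \<in> K"
  note hs = frame_operator_has_sum[OF x]
  \<comment> \<open>Projecting the series changes no term, so by uniqueness of sums its value is its
    own projection and lies in \<open>K\<close>.\<close>
  have "((\<lambda>i. proj K (cinner x (e i) *\<^sub>C e i)) has_sum proj K (frame_operator I e x)) I"
    by (rule has_sum_bounded_linear[OF bounded_linear_proj[OF K] hs])
  also have "?this \<longleftrightarrow> ((\<lambda>i. cinner x (e i) *\<^sub>C e i) has_sum proj K (frame_operator I e x)) I"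
    using K frame_in by (intro has_sum_cong) (auto simp: closed_csubspaceD(3))
  finally have "frame_operator I e x = proj K (frame_operator I e x)"
    using hs has_sum_unique by blast
  then show "frame_operator I e x \<in> K" using K by (metis proj_in)
  show "norm (frame_operator I e x) \<le> B * norm x"
  proof (rule tendsto_upperbound)
    show "((\<lambda>F. norm (\<Sum>i\<in>F. cinner x (e i) *\<^sub>C e i)) \<longlongrightarrow> norm (frame_operator I e x))
        (finite_subsets_at_top I)"
      using hs by (intro tendsto_norm) (simp add: has_sum_def)
    have "norm (\<Sum>i\<in>F. cinner x (e i) *\<^sub>C e i) \<le> B * norm x" if F: "finite F" "F \<subseteq> I" for F
    proof (rule power2_le_imp_le)
      have "(norm (\<Sum>i\<in>F. cinner x (e i) *\<^sub>C e i))\<^sup>2 \<le> B * (\<Sum>i\<in>F. (cmod (cinner x (e i)))\<^sup>2)"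
        using F by (rule norm_synthesis_le)
      also have "\<dots> \<le> B * (B * (norm x)\<^sup>2)"
        using frame_bounds F x by (intro mult_left_mono frame_coeff_finite) auto
      finally show "(norm (\<Sum>i\<in>F. cinner x (e i) *\<^sub>C e i))\<^sup>2 \<le> (B * norm x)\<^sup>2"
        by (simp add: power2_eq_square algebra_simps)
    qed (use frame_bounds in simp)
    then show "\<forall>\<^sub>F F in finite_subsets_at_top I. norm (\<Sum>i\<in>F. cinner x (e i) *\<^sub>C e i) \<le> B * norm x"
      by (intro eventually_finite_subsets_at_top_weakI)
  qed simp
  have "((\<lambda>i. (cmod (cinner x (e i)))\<^sup>2) has_sum inner (frame_operator I e x) x) I"
    using frame_operator_inner_has_sum[OF x, of x] by (simp add: cmod_power2 flip: power2_eq_square)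
  then show "A * (norm x)\<^sup>2 \<le> inner (frame_operator I e x) x"
    using frame_coeff(2)[OF x] by (simp add: infsumI)
  show "frame_operator I e (r *\<^sub>C x) = r *\<^sub>C frame_operator I e x" for r
  proof -
    have "((\<lambda>i. r *\<^sub>C cinner x (e i) *\<^sub>C e i) has_sum r *\<^sub>C frame_operator I e x) I"
      by (rule has_sum_bounded_linear[OF bounded_linear_scaleC hs])
    then show ?thesis
      by (simp add: frame_operator_def cinner_scaleC_left scaleC_scaleC infsumI)
  qed
  fix y assume y: "y \<in> K"
  have "((\<lambda>i. cinner x (e i) *\<^sub>C e i + - (cinner y (e i) *\<^sub>C e i)) has_sum
      frame_operator I e x + - frame_operator I e y) I"
    by (intro has_sum_add hs
        has_sum_bounded_linear[OF bounded_linear_minus[OF bounded_linear_ident]]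
        frame_operator_has_sum y)
  moreover have "cinner x (e i) *\<^sub>C e i - cinner y (e i) *\<^sub>C e i = cinner (x - y) (e i) *\<^sub>C e i" for i
    by (metis add_diff_cancel_right' cinner_add_left diff_add_cancel scaleC_add_left)
  ultimately show "frame_operator I e (x - y) = frame_operator I e x - frame_operator I e y"
    by (simp add: frame_operator_def infsumI)
  have "inner (frame_operator I e x) y = inner (frame_operator I e y) x"
    by (rule has_sum_unique[OF frame_operator_inner_has_sum[OF x]])
      (use frame_operator_inner_has_sum[OF y, of x] in \<open>simp add: mult.commute\<close>)
  then show "inner (frame_operator I e x) y = inner x (frame_operator I e y)"
    by (simp add: inner_commute)
qed (use K frame_bounds in \<open>auto simp: closed_csubspaceD\<close>)

end

section \<open>Weak integrals and Gram operators\<close>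

text \<open>The real scalar counterpart of \<open>has_weak_integral\<close>, with the same
  almost-everywhere convention.\<close>

definition has_iterated_integral ::
  "'w measure \<Rightarrow> ('w \<Rightarrow> 'v measure) \<Rightarrow> ('w \<Rightarrow> 'v \<Rightarrow> real) \<Rightarrow> real \<Rightarrow> bool" where
  "has_iterated_integral M N \<phi> r \<longleftrightarrow>
     (\<exists>h. integrable M h \<and>
        (AE w in M. integrable (N w) (\<phi> w) \<and> h w = (\<integral>v. \<phi> w v \<partial>N w)) \<and>
        (\<integral>w. h w \<partial>M) = r)"

lemma has_iterated_integral_unique:
  assumes "has_iterated_integral M N \<phi> r" "has_iterated_integral M N \<phi> s"
  shows "r = s"
proof -
  obtain h k where h: "integrable M h" "AE w in M. h w = (\<integral>v. \<phi> w v \<partial>N w)" "r = (\<integral>w. h w \<partial>M)"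
    and k: "integrable M k" "AE w in M. k w = (\<integral>v. \<phi> w v \<partial>N w)" "s = (\<integral>w. k w \<partial>M)"
    using assms unfolding has_iterated_integral_def by auto
  have "AE w in M. h w = k w" using h(2) k(2) by eventually_elim simp
  with h k show ?thesis by (auto intro: integral_cong_AE)
qed

lemma has_iterated_integral_cong:
  assumes "\<And>w v. w \<in> space M \<Longrightarrow> v \<in> space (N w) \<Longrightarrow> \<phi> w v = \<psi> w v"
  shows "has_iterated_integral M N \<phi> r \<longleftrightarrow> has_iterated_integral M N \<psi> r"
proof -
  have "integrable (N w) (\<phi> w) = integrable (N w) (\<psi> w) \<and> (\<integral>v. \<phi> w v \<partial>N w) = (\<integral>v. \<psi> w v \<partial>N w)"
    if "w \<in> space M" for w
    using assms[OF that] Bochner_Integration.integrable_cong[of "N w" "N w" "\<phi> w" "\<psi> w"]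
      Bochner_Integration.integral_cong[of "N w" "N w" "\<phi> w" "\<psi> w"] by simp
  then show ?thesis
    unfolding has_iterated_integral_def
    by (intro ex_cong1 conj_cong refl AE_cong) auto
qed

lemma has_iterated_integral_add:
  assumes "has_iterated_integral M N \<phi> r" "has_iterated_integral M N \<psi> s"
  shows "has_iterated_integral M N (\<lambda>w v. \<phi> w v + \<psi> w v) (r + s)"
proof -
  obtain h k where h: "integrable M h" "r = (\<integral>w. h w \<partial>M)"
      "AE w in M. integrable (N w) (\<phi> w) \<and> h w = (\<integral>v. \<phi> w v \<partial>N w)"
    and k: "integrable M k" "s = (\<integral>w. k w \<partial>M)"
      "AE w in M. integrable (N w) (\<psi> w) \<and> k w = (\<integral>v. \<psi> w v \<partial>N w)"
    using assms unfolding has_iterated_integral_def by auto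
  have "AE w in M. integrable (N w) (\<lambda>v. \<phi> w v + \<psi> w v) \<and>
      h w + k w = (\<integral>v. \<phi> w v + \<psi> w v \<partial>N w)"
    using h(3) k(3) by eventually_elim simp
  with h k show ?thesis
    unfolding has_iterated_integral_def by (intro exI[of _ "\<lambda>w. h w + k w"]) simp
qed

lemma has_iterated_integral_mult:
  assumes "has_iterated_integral M N \<phi> r"
  shows "has_iterated_integral M N (\<lambda>w v. c * \<phi> w v) (c * r)"
proof -
  obtain h where h: "integrable M h" "r = (\<integral>w. h w \<partial>M)"
      "AE w in M. integrable (N w) (\<phi> w) \<and> h w = (\<integral>v. \<phi> w v \<partial>N w)"
    using assms unfolding has_iterated_integral_def by auto
  have "AE w in M. integrable (N w) (\<lambda>v. c * \<phi> w v) \<and> c * h w = (\<integral>v. c * \<phi> w v \<partial>N w)"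
    using h(3) by eventually_elim simp
  with h show ?thesis
    unfolding has_iterated_integral_def by (intro exI[of _ "\<lambda>w. c * h w"]) simp
qed

text \<open>Testing with \<open>g\<close> and with \<open>\<i> *\<^sub>C g\<close> supplies the real
  and imaginary parts of the complex integrals.\<close>

lemma has_weak_integralI:
  assumes "\<And>g. has_iterated_integral M N (\<lambda>w v. inner (F w v) g) (inner x g)"
  shows "has_weak_integral M N F x"
  unfolding has_weak_integral_def
proof
  fix g
  obtain h where h: "integrable M h" "inner x g = (\<integral>w. h w \<partial>M)"
      "AE w in M. integrable (N w) (\<lambda>v. inner (F w v) g) \<and> h w = (\<integral>v. inner (F w v) g \<partial>N w)"
    using assms[of g] unfolding has_iterated_integral_def by auto
  obtain k where k: "integrable M k" "inner x (\<i> *\<^sub>C g) = (\<integral>w. k w \<partial>M)"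
      "AE w in M. integrable (N w) (\<lambda>v. inner (F w v) (\<i> *\<^sub>C g)) \<and>
         k w = (\<integral>v. inner (F w v) (\<i> *\<^sub>C g) \<partial>N w)"
    using assms[of "\<i> *\<^sub>C g"] unfolding has_iterated_integral_def by auto
  have split: "cinner y g = complex_of_real (inner y g) + \<i> * complex_of_real (inner y (\<i> *\<^sub>C g))" for y
    by (simp add: cinner_eq_Complex complex_eq_iff)
  show "\<exists>h. integrable M h \<and>
      (AE w in M. integrable (N w) (\<lambda>v. cinner (F w v) g) \<and> h w = (\<integral>v. cinner (F w v) g \<partial>N w)) \<and>
      (\<integral>w. h w \<partial>M) = cinner x g"
  proof (intro exI[of _ "\<lambda>w. complex_of_real (h w) + \<i> * complex_of_real (k w)"] conjI)
    show "AE w in M. integrable (N w) (\<lambda>v. cinner (F w v) g) \<and>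
        complex_of_real (h w) + \<i> * complex_of_real (k w) = (\<integral>v. cinner (F w v) g \<partial>N w)"
      using h(3) k(3) unfolding split by eventually_elim simp
  qed (use h k in \<open>simp_all add: split\<close>)
qed

text \<open>Test with the difference of the two values. This resolves the description in
  \<open>relay_frame_operator\<close>.\<close>

lemma has_weak_integral_unique:
  assumes "has_weak_integral M N F x" "has_weak_integral M N F y"
  shows "x = y"
proof -
  define g where "g = x - y"
  obtain h k where h: "integrable M h" "AE w in M. h w = (\<integral>v. cinner (F w v) g \<partial>N w)"
      "cinner x g = (\<integral>w. h w \<partial>M)"
    and k: "integrable M k" "AE w in M. k w = (\<integral>v. cinner (F w v) g \<partial>N w)"
      "cinner y g = (\<integral>w. k w \<partial>M)"
    using assms[unfolded has_weak_integral_def, THEN spec[of _ g]] by auto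
  have "AE w in M. h w = k w" using h(2) k(2) by eventually_elim simp
  with h k have "cinner x g = cinner y g" by (auto intro: integral_cong_AE)
  then have "inner (x - y) g = 0" unfolding inner_diff_left by (simp add: inner_eq_Re_cinner)
  then show ?thesis by (simp add: g_def)
qed

text \<open>Measurability is stated for squared norms; mixed inner products are reached from them by
  polarisation.\<close>

locale square_integrable_family =
  fixes M :: "'w measure" and N :: "'w \<Rightarrow> 'v measure"
    and \<Psi> :: "'w \<Rightarrow> 'v \<Rightarrow> 'h::chilbert \<Rightarrow> 'k::chilbert" and A B :: real
  assumes linear: "w \<in> space M \<Longrightarrow> v \<in> space (N w) \<Longrightarrow> linear (\<Psi> w v)"
    and measurable: "w \<in> space M \<Longrightarrow> (\<lambda>v. (norm (\<Psi> w v f))\<^sup>2) \<in> borel_measurable (N w)"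
    and measurable_inner: "(\<lambda>w. \<integral>\<^sup>+v. ennreal ((norm (\<Psi> w v f))\<^sup>2) \<partial>N w) \<in> borel_measurable M"
    and pos: "0 < A" "A \<le> B"
    and frame_lower: "ennreal (A * (norm f)\<^sup>2) \<le> (\<integral>\<^sup>+w. \<integral>\<^sup>+v. ennreal ((norm (\<Psi> w v f))\<^sup>2) \<partial>N w \<partial>M)"
    and frame_upper: "(\<integral>\<^sup>+w. \<integral>\<^sup>+v. ennreal ((norm (\<Psi> w v f))\<^sup>2) \<partial>N w \<partial>M) \<le> ennreal (B * (norm f)\<^sup>2)"
begin

text \<open>\<open>enn2real\<close> would send infinity to 0; \<open>frame_upper\<close> excludes
  that case.\<close>

definition Q :: "'h \<Rightarrow> real" where
  "Q f = enn2real (\<integral>\<^sup>+w. \<integral>\<^sup>+v. ennreal ((norm (\<Psi> w v f))\<^sup>2) \<partial>N w \<partial>M)"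

lemma B_nonneg: "0 \<le> B" using pos by simp

lemma Q_bounds: "A * (norm f)\<^sup>2 \<le> Q f" "Q f \<le> B * (norm f)\<^sup>2" "0 \<le> Q f"
proof -
  show "Q f \<le> B * (norm f)\<^sup>2" unfolding Q_def
    using frame_upper B_nonneg by (intro enn2real_leI) auto
  have "(\<integral>\<^sup>+w. \<integral>\<^sup>+v. ennreal ((norm (\<Psi> w v f))\<^sup>2) \<partial>N w \<partial>M) < top"
    using frame_upper[of f] by (auto simp: order_le_less_trans)
  with frame_lower[of f] show "A * (norm f)\<^sup>2 \<le> Q f" unfolding Q_def
    using pos enn2real_mono[of "ennreal (A * (norm f)\<^sup>2)"] by simp
qed (simp add: Q_def)

text \<open>A finite total forces the inner integral to be finite for almost every \<open>w\<close>;
  its real value serves as the version \<open>h\<close>.\<close>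

lemma Q_has_iterated_integral: "has_iterated_integral M N (\<lambda>w v. (norm (\<Psi> w v f))\<^sup>2) (Q f)"
proof -
  define q where "q w = (\<integral>\<^sup>+v. ennreal ((norm (\<Psi> w v f))\<^sup>2) \<partial>N w)" for w
  have q[measurable]: "q \<in> borel_measurable M" using measurable_inner by (simp add: q_def[abs_def])
  have fin: "(\<integral>\<^sup>+w. q w \<partial>M) < top"
    using frame_upper[of f] by (auto simp: q_def order_le_less_trans)
  then have qfin: "AE w in M. q w \<noteq> top" using nn_integral_PInf_AE[OF q] by (simp add: less_top)
  have eq: "(\<integral>\<^sup>+w. ennreal (enn2real (q w)) \<partial>M) = (\<integral>\<^sup>+w. q w \<partial>M)"
    using qfin by (intro nn_integral_cong_AE) (auto simp: less_top)
  have "AE w in M. integrable (N w) (\<lambda>v. (norm (\<Psi> w v f))\<^sup>2) \<and>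
      enn2real (q w) = (\<integral>v. (norm (\<Psi> w v f))\<^sup>2 \<partial>N w)"
    using qfin AE_space
  proof eventually_elim
    case (elim w)
    then show ?case using measurable[of w f]
      by (auto simp: q_def integral_eq_nn_integral less_top intro!: integrableI_nonneg)
  qed
  moreover have "integrable M (\<lambda>w. enn2real (q w))"
    using fin by (intro integrableI_nonneg) (auto simp: eq)
  moreover have "(\<integral>w. enn2real (q w) \<partial>M) = enn2real (\<integral>\<^sup>+w. q w \<partial>M)"
    by (subst integral_eq_nn_integral) (auto simp: eq)
  then have "(\<integral>w. enn2real (q w) \<partial>M) = Q f" by (simp add: Q_def q_def)
  ultimately show ?thesis unfolding has_iterated_integral_def by blast
qed

definition gram :: "'h \<Rightarrow> 'h \<Rightarrow> real" where
  "gram f g = (Q (f + g) - Q (f - g)) / 4"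

text \<open>Polarisation holds pointwise because each \<open>\<Psi> w v\<close> is linear, and it
  expresses the mixed integrand by two integrable squares.\<close>

lemma gram_has_iterated_integral:
  "has_iterated_integral M N (\<lambda>w v. inner (\<Psi> w v f) (\<Psi> w v g)) (gram f g)"
proof -
  have "has_iterated_integral M N (\<lambda>w v. (1/4) * ((norm (\<Psi> w v (f + g)))\<^sup>2 + (-1) * (norm (\<Psi> w v (f - g)))\<^sup>2))
      ((1/4) * (Q (f + g) + (-1) * Q (f - g)))"
    by (intro has_iterated_integral_mult has_iterated_integral_add Q_has_iterated_integral)
  also have "(1/4) * (Q (f + g) + (-1) * Q (f - g)) = gram f g" by (simp add: gram_def)
  also have "has_iterated_integral M N
      (\<lambda>w v. (1/4) * ((norm (\<Psi> w v (f + g)))\<^sup>2 + (-1) * (norm (\<Psi> w v (f - g)))\<^sup>2)) (gram f g)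
    \<longleftrightarrow> ?thesis"
    using linear
    by (intro has_iterated_integral_cong)
      (simp add: linear_add linear_diff power2_norm_eq_inner inner_simps inner_commute)
  finally show ?thesis .
qed

text \<open>This and the next three identities hold pointwise for the integrands, so uniqueness of
  iterated integrals carries them to \<open>gram\<close>.\<close>

lemma gram_commute: "gram f g = gram g f"
  using has_iterated_integral_unique[OF gram_has_iterated_integral[of f g]]
    gram_has_iterated_integral[of g f] by (simp add: inner_commute)

lemma gram_self: "gram f f = Q f"
  using has_iterated_integral_unique[OF gram_has_iterated_integral[of f f]]
    Q_has_iterated_integral[of f] by (simp add: power2_norm_eq_inner)

lemma gram_add: "gram f (g + g') = gram f g + gram f g'"
proof (rule has_iterated_integral_unique[OF gram_has_iterated_integral])
  show "has_iterated_integral M N (\<lambda>w v. inner (\<Psi> w v f) (\<Psi> w v (g + g'))) (gram f g + gram f g')"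
    using has_iterated_integral_add[OF gram_has_iterated_integral[of f g] gram_has_iterated_integral[of f g']]
    by (rule has_iterated_integral_cong[THEN iffD1, rotated])
      (simp add: linear linear_add inner_add_right)
qed

lemma gram_scaleR: "gram f (r *\<^sub>R g) = r * gram f g"
proof (rule has_iterated_integral_unique[OF gram_has_iterated_integral])
  show "has_iterated_integral M N (\<lambda>w v. inner (\<Psi> w v f) (\<Psi> w v (r *\<^sub>R g))) (r * gram f g)"
    using has_iterated_integral_mult[OF gram_has_iterated_integral[of f g], of r]
    by (rule has_iterated_integral_cong[THEN iffD1, rotated]) (simp add: linear linear_scale)
qed

text \<open>On unit vectors polarisation and the parallelogram law give the bound \<open>B\<close>;
  homogeneity gives the rest.\<close>

lemma gram_bound: "\<bar>gram f g\<bar> \<le> B * norm f * norm g"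
proof (cases "f = 0 \<or> g = 0")
  case True
  then show ?thesis
    using gram_scaleR[of f 0 0] gram_scaleR[of g 0 0] gram_commute[of f g] by auto
next
  case False
  have unit: "\<bar>gram x y\<bar> \<le> B" if "norm x = 1" "norm y = 1" for x y
  proof -
    have "\<bar>gram x y\<bar> \<le> (Q (x + y) + Q (x - y)) / 4"
      using Q_bounds(3)[of "x + y"] Q_bounds(3)[of "x - y"] by (auto simp: gram_def abs_le_iff field_simps)
    also have "\<dots> \<le> (B * (norm (x + y))\<^sup>2 + B * (norm (x - y))\<^sup>2) / 4"
      by (intro divide_right_mono add_mono Q_bounds) auto
    also have "\<dots> = B * ((norm (x + y))\<^sup>2 + (norm (x - y))\<^sup>2) / 4" by (simp add: distrib_left)
    also have "(norm (x + y))\<^sup>2 + (norm (x - y))\<^sup>2 = 2 * (norm x)\<^sup>2 + 2 * (norm y)\<^sup>2"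
      by (simp add: power2_norm_eq_inner inner_simps inner_commute)
    finally show ?thesis by (simp add: that)
  qed
  have "\<bar>gram (f /\<^sub>R norm f) (g /\<^sub>R norm g)\<bar> \<le> B" using False by (intro unit) auto
  also have "gram (f /\<^sub>R norm f) (g /\<^sub>R norm g) = gram f g / (norm f * norm g)"
    using gram_scaleR gram_commute by (metis (no_types) divide_inverse inverse_mult_distrib mult.commute mult.left_commute)
  finally show ?thesis using False by (simp add: abs_mult field_simps)
qed

definition gram_op :: "'h \<Rightarrow> 'h" where
  "gram_op f = (SOME y. \<forall>g. gram f g = inner y g)"

text \<open>By \<open>gram_bound\<close> the functional \<open>gram f\<close> is bounded, so Riesz
  supplies the vector chosen in \<open>gram_op\<close>.\<close>

lemma inner_gram_op: "inner (gram_op f) g = gram f g"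
proof -
  have "bounded_linear (gram f)"
    using gram_bound[of f]
    by (intro bounded_linear_intro[where K="B * norm f"]) (auto simp: gram_add gram_scaleR mult_ac)
  then have "\<exists>y. \<forall>g. gram f g = inner y g"
    by (rule riesz_on_closed_subspace[OF closed_UNIV subspace_UNIV]) auto
  from someI_ex[OF this, THEN spec, symmetric] show ?thesis unfolding gram_op_def .
qed

lemma gram_op_selfadjoint: "inner (gram_op f) g = inner f (gram_op g)"
  using inner_gram_op[of f g] inner_gram_op[of g f] gram_commute[of f g] inner_commute[of f "gram_op g"] by argo

text \<open>The lower bound is that of \<open>Q\<close>. For the upper one, take
  \<open>gram_op x\<close> itself as second argument of \<open>gram_bound\<close> and cancel one
  norm.\<close>

lemma gram_op_coercive_on: "coercive_on UNIV gram_op B A"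
proof
  fix x y
  have "inner (gram_op (x - y)) z = inner (gram_op x - gram_op y) z" for z
    by (simp add: gram_op_selfadjoint inner_diff_left)
  then show "gram_op (x - y) = gram_op x - gram_op y" by (rule vector_eq_rdot[THEN iffD1, OF allI])
  show "A * (norm x)\<^sup>2 \<le> inner (gram_op x) x" by (simp add: inner_gram_op gram_self Q_bounds)
  have "(norm (gram_op x))\<^sup>2 = gram x (gram_op x)"
    by (simp add: power2_norm_eq_inner inner_gram_op)
  then have "norm (gram_op x) * norm (gram_op x) \<le> B * norm x * norm (gram_op x)"
    using gram_bound[of x "gram_op x"] by (simp add: power2_eq_square)
  then show "norm (gram_op x) \<le> B * norm x"
    using B_nonneg by (cases "gram_op x = 0") auto
qed (use pos in auto)

lemma bij_gram_op: "bij gram_op"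
  using coercive_on.bij[OF gram_op_coercive_on] .

lemma gram_op_inv: "gram_op (inv gram_op f) = f"
  using bij_gram_op by (simp add: bij_is_surj surj_f_inv_f)

text \<open>Used for the frame operator itself and for the reconstruction formula with the inverse
  applied to \<open>f\<close> first.\<close>

lemma gram_op_weak_integral:
  assumes "\<And>w v g. w \<in> space M \<Longrightarrow> v \<in> space (N w) \<Longrightarrow> inner (F w v) g = inner (\<Psi> w v f) (\<Psi> w v g)"
  shows "has_weak_integral M N F (gram_op f)"
proof (rule has_weak_integralI)
  fix g
  show "has_iterated_integral M N (\<lambda>w v. inner (F w v) g) (inner (gram_op f) g)"
    unfolding inner_gram_op using gram_has_iterated_integral[of f g]
    by (rule has_iterated_integral_cong[THEN iffD1, rotated]) (simp add: assms)
qed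

text \<open>Serves the formula with the inverse inside the integral. As \<open>gram_op\<close> is
  onto, it suffices to test against vectors \<open>gram_op g\<close>, where self-adjointness cancels
  the inverse.\<close>

lemma inv_gram_op_weak_integral:
  assumes "\<And>w v g. w \<in> space M \<Longrightarrow> v \<in> space (N w) \<Longrightarrow>
    inner (F w v) (gram_op g) = inner (\<Psi> w v f) (\<Psi> w v g)"
  shows "has_weak_integral M N F f"
proof (rule has_weak_integralI)
  fix g
  have "has_iterated_integral M N (\<lambda>w v. inner (\<Psi> w v f) (\<Psi> w v (inv gram_op g))) (inner f g)"
    using gram_has_iterated_integral[of f "inv gram_op g"]
    unfolding inner_gram_op[symmetric] by (simp only: gram_op_selfadjoint gram_op_inv)
  then show "has_iterated_integral M N (\<lambda>w v. inner (F w v) g) (inner f g)"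
    by (rule has_iterated_integral_cong[THEN iffD1, rotated])
      (use assms[of _ _ "inv gram_op g"] in \<open>simp add: gram_op_inv\<close>)
qed

end

section \<open>The canonical relay fusion frame\<close>

lemma bounded_clinear_comp:
  "bounded_clinear f \<Longrightarrow> bounded_clinear g \<Longrightarrow> bounded_clinear (\<lambda>x. f (g x))"
  by (simp add: bounded_clinear_def bounded_linear_compose)

text \<open>For empty \<open>X\<close> nothing is known about \<open>C\<close> and \<open>D\<close>, so other bounds have to be chosen.\<close>

lemma frame_operators_positive_on:
  assumes "\<And>w. w \<in> X \<Longrightarrow> frame_for (I w) (e w) (K w) C D \<and> closed_csubspace (K w)"
  obtains C' D' where "0 < C'" "C' \<le> D'"
    "\<And>w. w \<in> X \<Longrightarrow> positive_on (K w) (frame_operator (I w) (e w)) D' C'"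
proof (cases "X = {}")
  case True
  then show ?thesis using that[of 1 1] by simp
next
  case False
  then obtain w where "w \<in> X" by auto
  with assms have "0 < C" "C \<le> D" using frame_bounds by blast+
  with assms show ?thesis using that[of C D] frame_operator_positive_on by blast
qed

theorem theorem3p3:
  fixes M :: "'w measure" and N :: "'w \<Rightarrow> 'v measure"
    and K :: "'w \<Rightarrow> 'k::{chilbert, second_countable_topology} set"
    and W :: "'w \<Rightarrow> 'h::{chilbert, second_countable_topology} set"
    and V :: "'w \<Rightarrow> 'v \<Rightarrow> 'k set"
    and \<Lambda> :: "'w \<Rightarrow> 'h \<Rightarrow> 'k"
    and \<alpha> :: "'w \<Rightarrow> 'v \<Rightarrow> real"
    and I :: "'w \<Rightarrow> 'i set" and e :: "'w \<Rightarrow> 'i \<Rightarrow> 'k"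
    and A B C D :: real
  defines "S \<equiv> (\<lambda>w. frame_operator (I w) (e w))"
  defines "S' \<equiv> (\<lambda>w. inv_into (K w) (S w))"
  defines "V' \<equiv> (\<lambda>w v. S' w ` V w v)"
  defines "\<Lambda>' \<equiv> (\<lambda>w v f. S' w (proj (V w v) (\<Lambda> w f)))"
  defines "R' \<equiv> relay_frame_operator M N W V' \<Lambda>' \<alpha>"
  assumes relay: "relay_fusion_frame M N K W V \<Lambda> \<alpha> A B"
    and frames: "\<And>w. w \<in> space M \<Longrightarrow> frame_for (I w) (e w) (K w) C D"
    and meas: "\<And>f. (\<lambda>w. \<integral>\<^sup>+v. ennreal ((\<alpha> w v)\<^sup>2 * (norm (\<Lambda>' w v (proj (W w) f)))\<^sup>2) \<partial>N w)
                 \<in> borel_measurable M"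
  shows "(\<exists>A' B'. relay_fusion_frame2 M N K W V' \<Lambda>' \<alpha> A' B') \<and>
         bij R' \<and>
         (\<forall>f. has_weak_integral M N
                (\<lambda>w v. (\<alpha> w v)\<^sup>2 *\<^sub>R
                   inv R' (proj (W w) (cadjoint (\<Lambda>' w v) (\<Lambda>' w v (proj (W w) f))))) f \<and>
              has_weak_integral M N
                (\<lambda>w v. (\<alpha> w v)\<^sup>2 *\<^sub>R
                   proj (W w) (cadjoint (\<Lambda>' w v) (\<Lambda>' w v (proj (W w) (inv R' f))))) f)"
proof -
  define q where "q f w = (\<integral>\<^sup>+v. ennreal ((\<alpha> w v)\<^sup>2 *
      (norm (proj (V w v) (\<Lambda> w (proj (W w) f))))\<^sup>2) \<partial>N w)" for f w
  define q' where "q' f w = (\<integral>\<^sup>+v. ennreal ((\<alpha> w v)\<^sup>2 *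
      (norm (\<Lambda>' w v (proj (W w) f)))\<^sup>2) \<partial>N w)" for f w
  \<comment> \<open>The weight is absorbed, so the squared norm of \<open>\<Psi>\<close> is the
    integrand of the new frame inequality.\<close>
  define \<Psi> where "\<Psi> w v f = \<alpha> w v *\<^sub>R \<Lambda>' w v (proj (W w) f)" for w v f
  note relay = relay[unfolded relay_fusion_frame_def relay_fusion_frame2_def Let_def, folded q_def]
  have AB: "0 < A" "A \<le> B"
    and KW: "\<And>w. w \<in> space M \<Longrightarrow> closed_csubspace (K w) \<and> closed_csubspace (W w)"
    and Vs: "\<And>w v. w \<in> space M \<Longrightarrow> v \<in> space (N w) \<Longrightarrow>
        closed_csubspace (V w v) \<and> V w v \<subseteq> K w \<and> 0 < \<alpha> w v"
    and \<Lambda>: "\<And>w. w \<in> space M \<Longrightarrow> bounded_clinear (\<Lambda> w)" "\<And>w f. w \<in> space M \<Longrightarrow> \<Lambda> w f \<in> K w"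
    and W_meas: "\<And>f. (\<lambda>w. proj (W w) f) \<in> borel_measurable M"
    and V_meas: "\<And>w f. w \<in> space M \<Longrightarrow> f \<in> K w \<Longrightarrow> (\<lambda>v. proj (V w v) f) \<in> borel_measurable (N w)"
    and \<alpha>_meas: "\<And>w. w \<in> space M \<Longrightarrow> \<alpha> w \<in> borel_measurable (N w)"
    and q: "\<And>f. q f \<in> borel_measurable M"
      "\<And>f. ennreal (A * (norm f)\<^sup>2) \<le> (\<integral>\<^sup>+w. q f w \<partial>M)"
      "\<And>f. (\<integral>\<^sup>+w. q f w \<partial>M) \<le> ennreal (B * (norm f)\<^sup>2)"
    using relay by (auto simp: image_subset_iff)
  \<comment> \<open>One pair of bounds serves all \<open>w\<close>, so it can be pulled out of the
    outer integral.\<close>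
  obtain c b where cb: "0 < c" "c \<le> b" and S: "\<And>w. w \<in> space M \<Longrightarrow> positive_on (K w) (S w) b c"
    unfolding S_def using frame_operators_positive_on[of "space M" I e K C D] frames KW by metis

  \<comment> \<open>Pointwise properties of the transformed subspaces and operators\<close>
  have csub: "closed_csubspace (V' w v)" "V' w v \<subseteq> K w"
    and L: "bounded_clinear (\<Lambda>' w v)" "\<Lambda>' w v f \<in> V' w v"
    and norm_L: "norm (proj (V w v) (\<Lambda> w f)) / b \<le> norm (\<Lambda>' w v f)"
      "norm (\<Lambda>' w v f) \<le> norm (proj (V w v) (\<Lambda> w f)) / c"
    if w: "w \<in> space M" and v: "v \<in> space (N w)" for w v f
  proof -
    interpret positive_on "K w" "S w" b c using w by (rule S)
    have Vwv: "closed_csubspace (V w v)" "V w v \<subseteq> K w" using Vs[OF w v] by auto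
    then have in_K: "proj (V w v) x \<in> K w" for x by auto
    show "closed_csubspace (V' w v)"
      unfolding V'_def S'_def by (rule closed_csubspace_image_T[OF Vwv])
    show "V' w v \<subseteq> K w" unfolding V'_def S'_def using Vwv(2) by auto
    show "bounded_clinear (\<Lambda>' w v)"
      unfolding \<Lambda>'_def S'_def
      by (rule bounded_clinear_T_comp[OF bounded_clinear_comp[OF bounded_clinear_proj[OF Vwv(1)]
              \<Lambda>(1)[OF w]] in_K])
    show "\<Lambda>' w v f \<in> V' w v" using Vwv by (auto simp: \<Lambda>'_def V'_def)
    show "norm (proj (V w v) (\<Lambda> w f)) / b \<le> norm (\<Lambda>' w v f)"
      "norm (\<Lambda>' w v f) \<le> norm (proj (V w v) (\<Lambda> w f)) / c"
      unfolding \<Lambda>'_def S'_def by (intro norm_T_ge norm_T_le in_K)+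
  qed
  have L_meas: "(\<lambda>v. \<Lambda>' w v f) \<in> borel_measurable (N w)" if w: "w \<in> space M" for w f
    unfolding \<Lambda>'_def S'_def
    by (rule positive_on.measurable_T[OF S[OF w] V_meas[OF w \<Lambda>(2)[OF w]]]) (use Vs[OF w] proj_in in blast)
  \<comment> \<open>\<open>\<Lambda>'\<close> already takes values in \<open>V'\<close>, so the
    projection onto \<open>V'\<close> acts as the identity.\<close>
  have q'_eq: "(\<integral>\<^sup>+v. ennreal ((\<alpha> w v)\<^sup>2 *
      (norm (proj (V' w v) (\<Lambda>' w v (proj (W w) f))))\<^sup>2) \<partial>N w) = q' f w" if "w \<in> space M" for f w
    unfolding q'_def using csub(1) L(2) that by (intro nn_integral_cong) simp
  have q'_meas: "q' f \<in> borel_measurable M" for f using meas by (simp add: q'_def[abs_def])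
  have \<Psi>_q': "(\<integral>\<^sup>+v. ennreal ((norm (\<Psi> w v f))\<^sup>2) \<partial>N w) = q' f w" for w f
    by (simp add: \<Psi>_def q'_def power_mult_distrib)
  have q_inner_meas: "(\<lambda>v. ennreal ((\<alpha> w v)\<^sup>2 * (norm (proj (V w v) (\<Lambda> w (proj (W w) f))))\<^sup>2))
      \<in> borel_measurable (N w)" if "w \<in> space M" for f w
    using V_meas[OF that \<Lambda>(2)[OF that]] \<alpha>_meas[OF that] by measurable

  \<comment> \<open>Comparison of the old and new frame integrals\<close>
  have q_le: "ennreal (1 / b\<^sup>2) * q f w \<le> q' f w" if w: "w \<in> space M" for f w
    unfolding q_def q'_def nn_integral_cmult[OF q_inner_meas[OF w], symmetric]
  proof (intro nn_integral_mono)
    fix v assume v: "v \<in> space (N w)"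
    let ?p = "norm (proj (V w v) (\<Lambda> w (proj (W w) f)))"
    have "(\<alpha> w v)\<^sup>2 * (?p / b)\<^sup>2 \<le> (\<alpha> w v)\<^sup>2 * (norm (\<Lambda>' w v (proj (W w) f)))\<^sup>2"
      using norm_L(1)[OF w v] cb by (intro mult_left_mono power_mono) auto
    then show "ennreal (1 / b\<^sup>2) * ennreal ((\<alpha> w v)\<^sup>2 * ?p\<^sup>2)
        \<le> ennreal ((\<alpha> w v)\<^sup>2 * (norm (\<Lambda>' w v (proj (W w) f)))\<^sup>2)"
      by (simp add: power_divide flip: ennreal_mult)
  qed
  have le_q: "q' f w \<le> ennreal (1 / c\<^sup>2) * q f w" if w: "w \<in> space M" for f w
    unfolding q_def q'_def nn_integral_cmult[OF q_inner_meas[OF w], symmetric]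
  proof (intro nn_integral_mono)
    fix v assume v: "v \<in> space (N w)"
    let ?p = "norm (proj (V w v) (\<Lambda> w (proj (W w) f)))"
    have "(\<alpha> w v)\<^sup>2 * (norm (\<Lambda>' w v (proj (W w) f)))\<^sup>2 \<le> (\<alpha> w v)\<^sup>2 * (?p / c)\<^sup>2"
      using norm_L(2)[OF w v] cb by (intro mult_left_mono power_mono) auto
    then show "ennreal ((\<alpha> w v)\<^sup>2 * (norm (\<Lambda>' w v (proj (W w) f)))\<^sup>2)
        \<le> ennreal (1 / c\<^sup>2) * ennreal ((\<alpha> w v)\<^sup>2 * ?p\<^sup>2)"
      by (simp add: power_divide flip: ennreal_mult)
  qed
  have lower: "ennreal (A / b\<^sup>2 * (norm f)\<^sup>2) \<le> (\<integral>\<^sup>+w. q' f w \<partial>M)" for f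
  proof -
    have "ennreal (A / b\<^sup>2 * (norm f)\<^sup>2) = ennreal (1 / b\<^sup>2) * ennreal (A * (norm f)\<^sup>2)"
      using AB by (simp flip: ennreal_mult)
    also have "\<dots> \<le> ennreal (1 / b\<^sup>2) * (\<integral>\<^sup>+w. q f w \<partial>M)" using q(2) by (intro mult_left_mono) auto
    also have "\<dots> = (\<integral>\<^sup>+w. ennreal (1 / b\<^sup>2) * q f w \<partial>M)"
      using q(1) by (rule nn_integral_cmult[symmetric])
    also have "\<dots> \<le> (\<integral>\<^sup>+w. q' f w \<partial>M)" using q_le by (intro nn_integral_mono)
    finally show ?thesis .
  qed
  have upper: "(\<integral>\<^sup>+w. q' f w \<partial>M) \<le> ennreal (B / c\<^sup>2 * (norm f)\<^sup>2)" for f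
  proof -
    have "(\<integral>\<^sup>+w. q' f w \<partial>M) \<le> (\<integral>\<^sup>+w. ennreal (1 / c\<^sup>2) * q f w \<partial>M)"
      using le_q by (intro nn_integral_mono)
    also have "\<dots> = ennreal (1 / c\<^sup>2) * (\<integral>\<^sup>+w. q f w \<partial>M)"
      using q(1) by (rule nn_integral_cmult)
    also have "\<dots> \<le> ennreal (1 / c\<^sup>2) * ennreal (B * (norm f)\<^sup>2)"
      using q(3) by (intro mult_left_mono) auto
    also have "\<dots> = ennreal (B / c\<^sup>2 * (norm f)\<^sup>2)"
      using AB by (simp flip: ennreal_mult)
    finally show ?thesis .
  qed
  have pos: "0 < A / b\<^sup>2" "A / b\<^sup>2 \<le> B / c\<^sup>2"
    using AB cb by (auto intro!: frac_le power_mono)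

  \<comment> \<open>The transformed family as a relay fusion frame\<close>
  have frame2: "relay_fusion_frame2 M N K W V' \<Lambda>' \<alpha> (A / b\<^sup>2) (B / c\<^sup>2)"
    unfolding relay_fusion_frame2_def Let_def
  proof (intro conjI ballI allI pos)
    fix f
    let ?p = "\<lambda>w. \<integral>\<^sup>+v. ennreal ((\<alpha> w v)\<^sup>2 * (norm (proj (V' w v) (\<Lambda>' w v (proj (W w) f))))\<^sup>2) \<partial>N w"
    show "?p \<in> borel_measurable M" using q'_meas q'_eq by (simp cong: measurable_cong)
    have "(\<integral>\<^sup>+w. ?p w \<partial>M) = (\<integral>\<^sup>+w. q' f w \<partial>M)" using q'_eq by (rule nn_integral_cong)
    then show "ennreal (A / b\<^sup>2 * (norm f)\<^sup>2) \<le> (\<integral>\<^sup>+w. ?p w \<partial>M)"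
      "(\<integral>\<^sup>+w. ?p w \<partial>M) \<le> ennreal (B / c\<^sup>2 * (norm f)\<^sup>2)"
      using lower upper by simp_all
  next
    fix w f assume w: "w \<in> space M" and f: "f \<in> K w"
    show "(\<lambda>v. proj (V' w v) f) \<in> borel_measurable (N w)"
      unfolding V'_def S'_def
      by (rule measurable_proj_image_inv_into[OF S[OF w] _ V_meas[OF w] f]) (use Vs w in blast)+
  next
    fix w v assume "w \<in> space M" "v \<in> space (N w)"
    then show "range (\<Lambda>' w v) \<subseteq> K w" using L(2) csub(2) by blast
  qed (use KW Vs csub L(1) L_meas W_meas \<alpha>_meas in auto)
  interpret square_integrable_family M N \<Psi> "A / b\<^sup>2" "B / c\<^sup>2"
  proof (rule square_integrable_family.intro)
    fix w v assume w: "w \<in> space M" and v: "v \<in> space (N w)"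
    then show "linear (\<Psi> w v)"
      unfolding \<Psi>_def using KW[OF w] L(1)[OF w v]
        bounded_linear_compose[OF _ bounded_linear_proj, of "\<Lambda>' w v" "W w"]
      by (intro linear_compose_scale_right bounded_linear.linear) (simp add: bounded_clinear_def)
  next
    fix w f assume "w \<in> space M"
    then show "(\<lambda>v. (norm (\<Psi> w v f))\<^sup>2) \<in> borel_measurable (N w)"
      unfolding \<Psi>_def using L_meas \<alpha>_meas by measurable
  qed (use pos q'_meas lower upper in \<open>simp_all add: \<Psi>_q'\<close>)
  \<comment> \<open>Move the projection and the adjoint to the other side and split the squared
    weight between the two factors.\<close>
  have inner_F: "inner ((\<alpha> w v)\<^sup>2 *\<^sub>R proj (W w) (cadjoint (\<Lambda>' w v) (\<Lambda>' w v (proj (W w) f)))) g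
      = inner (\<Psi> w v f) (\<Psi> w v g)" if "w \<in> space M" "v \<in> space (N w)" for w v f g
    using KW that L(1)
    by (simp add: \<Psi>_def inner_proj inner_cadjoint power2_eq_square)
  \<comment> \<open>The integrand of the frame operator represents the Gram integrand weakly, and
    weak integrals are unique.\<close>
  have R'_eq: "R' = gram_op"
  proof
    fix f
    have F: "has_weak_integral M N (\<lambda>w v. (\<alpha> w v)\<^sup>2 *\<^sub>R
        proj (W w) (cadjoint (\<Lambda>' w v) (proj (V' w v) (\<Lambda>' w v (proj (W w) f))))) (gram_op f)"
      using csub(1) L(2) by (intro gram_op_weak_integral) (simp only: proj_idem inner_F)
    show "R' f = gram_op f"
      unfolding R'_def relay_frame_operator_def
      by (rule the_equality[where P="has_weak_integral M N _", OF F has_weak_integral_unique[OF _ F]])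
  qed
  show ?thesis
    unfolding R'_eq
  proof (intro conjI allI exI bij_gram_op)
    show "relay_fusion_frame2 M N K W V' \<Lambda>' \<alpha> (A / b\<^sup>2) (B / c\<^sup>2)" by (rule frame2)
    fix f
    show "has_weak_integral M N (\<lambda>w v. (\<alpha> w v)\<^sup>2 *\<^sub>R
        inv gram_op (proj (W w) (cadjoint (\<Lambda>' w v) (\<Lambda>' w v (proj (W w) f))))) f"
    proof (rule inv_gram_op_weak_integral)
      fix w v g assume wv: "w \<in> space M" "v \<in> space (N w)"
      then show "inner ((\<alpha> w v)\<^sup>2 *\<^sub>R inv gram_op (proj (W w) (cadjoint (\<Lambda>' w v)
          (\<Lambda>' w v (proj (W w) f))))) (gram_op g) = inner (\<Psi> w v f) (\<Psi> w v g)"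
        using inner_F[OF wv, of f g]
        by (simp only: inner_scaleR_left gram_op_selfadjoint[symmetric, of "inv gram_op _"] gram_op_inv)
    qed
    \<comment> \<open>The weak integral for the vector \<open>inv gram_op f\<close> has value
      \<open>gram_op (inv gram_op f)\<close>, which is \<open>f\<close>.\<close>
    have "has_weak_integral M N (\<lambda>w v. (\<alpha> w v)\<^sup>2 *\<^sub>R proj (W w) (cadjoint (\<Lambda>' w v)
        (\<Lambda>' w v (proj (W w) (inv gram_op f))))) (gram_op (inv gram_op f))"
      by (rule gram_op_weak_integral) (rule inner_F)
    then show "has_weak_integral M N (\<lambda>w v. (\<alpha> w v)\<^sup>2 *\<^sub>R proj (W w) (cadjoint (\<Lambda>' w v)
        (\<Lambda>' w v (proj (W w) (inv gram_op f))))) f"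
      by (simp add: gram_op_inv)
  qed
qed

end
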